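(* Let $N\ge 2$ and let $r,s$ be coprime positive integers with $N\le r$. Let $V\subset S_r$ be a general linear subspace of dimension $N+1$. Then every nonzero linear subspace $W\subset S_{s-1}$ satisfies $\eta(V\cdot W)\ge\eta(W)$ if and only if $s/r\in\Phi_N$.
   Context: Over $\mathbb{C}$, $S_a=H^0(\mathcal{O}_{\mathbb{P}^1}(a))$ denotes the space of homogeneous polynomials of degree $a$ in two variables $u,v$ (so $\dim S_a=a+1$; $S_{-1}=0$). For subspaces $V,W$, $V\cdot W$ denotes the linear span of all products $fg$, $f\in V$, $g\in W$. For a subspace $W\subset S_{t-1}$ put $\eta(W)=\dim W/t$ (so for $W\subset S_{s-1}$, $\eta(W)=\dim W/s$, and $V\cdot W\subset S_{r+s-1}$ has $\eta(V\cdot W)=\dim(V\cdot W)/(r+s)$). "General" means lying in a nonempty Zariski-open subset of the Grassmannian. Define $\rho_N(x)=\dfrac{1}{N-1+\frac{1}{1+x}}$, $\rho_N^0=\mathrm{id}$, $\rho_N^{i+1}=\rho_N\circ\rho_N^i$, $\phi_N=\lim_{i\to\infty}\rho_N^i(0)$, and $\Phi_N=\{\alpha\in\mathbb{Q}:\alpha>\phi_N\}\cup\{\rho_N^i(0):i\ge 0\}$. *)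

theory Defs
  imports Complex_Main "HOL-Computational_Algebra.Polynomial"
begin

text \<open>Binary forms of degree a in u,v are identified with univariate complex polynomials
 of degree at most a (dehomogenisation v = 1); multiplication of forms corresponds to
 multiplication of polynomials, degrees adding.  Linear algebra over the complex numbers
 is done with the scalar multiplication smult.\<close>

abbreviation cspan :: "complex poly set \<Rightarrow> complex poly set" where
  "cspan \<equiv> module.span (smult :: complex \<Rightarrow> complex poly \<Rightarrow> complex poly)"

abbreviation csubspace :: "complex poly set \<Rightarrow> bool" where
  "csubspace \<equiv> module.subspace (smult :: complex \<Rightarrow> complex poly \<Rightarrow> complex poly)"

abbreviation cdim :: "complex poly set \<Rightarrow> nat" where
  "cdim \<equiv> vector_space.dim (smult :: complex \<Rightarrow> complex poly \<Rightarrow> complex poly)"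

definition S :: "nat \<Rightarrow> complex poly set" where
  "S a = {p. degree p \<le> a}"

definition prodsp :: "complex poly set \<Rightarrow> complex poly set \<Rightarrow> complex poly set" where
  "prodsp V W = cspan {f * g | f g. f \<in> V \<and> g \<in> W}"

text \<open>eta W = dim W / t for W a subspace of S (t-1).\<close>
definition eta :: "nat \<Rightarrow> complex poly set \<Rightarrow> real" where
  "eta t W = real (cdim W) / real t"

definition rho :: "nat \<Rightarrow> real \<Rightarrow> real" where
  "rho N x = 1 / (real N - 1 + 1 / (1 + x))"

definition phi :: "nat \<Rightarrow> real" where
  "phi N = lim (\<lambda>i. (rho N ^^ i) 0)"

definition Phi :: "nat \<Rightarrow> real set" where
  "Phi N = {\<alpha>. \<alpha> \<in> \<rat> \<and> \<alpha> > phi N} \<union> {(rho N ^^ i) 0 | i. True}"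

text \<open>Polynomial functions in the variables x 0, ..., x (n-1) on complex affine n-space
 (points are represented as functions nat => complex; coordinates >= n are ignored).\<close>
inductive polyfun :: "nat \<Rightarrow> ((nat \<Rightarrow> complex) \<Rightarrow> complex) \<Rightarrow> bool" for n where
  const: "polyfun n (\<lambda>x. c)"
| var: "i < n \<Longrightarrow> polyfun n (\<lambda>x. x i)"
| add: "polyfun n F \<Longrightarrow> polyfun n G \<Longrightarrow> polyfun n (\<lambda>x. F x + G x)"
| mult: "polyfun n F \<Longrightarrow> polyfun n G \<Longrightarrow> polyfun n (\<lambda>x. F x * G x)"

text \<open>P holds for a general point of affine n-space: it holds on a nonempty Zariski-open
 subset, i.e. (basic opens forming a basis) on the non-vanishing locus of a polynomial
 function that is not identically zero.\<close>
definition general_pt :: "nat \<Rightarrow> ((nat \<Rightarrow> complex) \<Rightarrow> bool) \<Rightarrow> bool" where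
  "general_pt n P \<longleftrightarrow> (\<exists>F. polyfun n F \<and> (\<exists>x. F x \<noteq> 0) \<and> (\<forall>x. F x \<noteq> 0 \<longrightarrow> P x))"

definition tuple_form :: "nat \<Rightarrow> (nat \<Rightarrow> complex) \<Rightarrow> nat \<Rightarrow> complex poly" where
  "tuple_form r x i = (\<Sum>j\<le>r. monom (x (i * (r + 1) + j)) j)"

definition span_of_coeffs :: "nat \<Rightarrow> nat \<Rightarrow> (nat \<Rightarrow> complex) \<Rightarrow> complex poly set" where
  "span_of_coeffs k r x = cspan (tuple_form r x ` {..<k})"

text \<open>A property P of (k-dimensional) subspaces of S r holds for a general
 V in the Grassmannian G(k, S r): pulled back along the (open, surjective) map from
 linearly independent k-tuples of forms to their span, it holds on a nonempty
 Zariski-open set of tuples, each spanning a k-dimensional subspace.\<close>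
definition general_subspace :: "nat \<Rightarrow> nat \<Rightarrow> (complex poly set \<Rightarrow> bool) \<Rightarrow> bool" where
  "general_subspace k r P \<longleftrightarrow>
     general_pt (k * (r + 1)) (\<lambda>x. cdim (span_of_coeffs k r x) = k \<and> P (span_of_coeffs k r x))"

end

theory Submission
  imports Defs "Jordan_Normal_Form.Determinant"
begin

text \<open>Multiplication by a basis of V makes the pair of spaces S (s - 1), S (r + s - 1) into a module
  over the Kronecker quiver with N + 1 arrows, of dimension vector (s, n) with n = r + s, and the
  inequality for all W is semistability of this module.  Reflection functors act on
  the slopes s / (n - s) by the map rho N.

  If the slope is not in Phi N, reflecting repeatedly leads to a module with more than (N + 1) s target
  dimensions, which is visibly unstable; a destabilising subspace is carried back along the reflections.

  If the slope is in Phi N, it is enough to find one V and one tuple of matrices A i such that the sum of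
  the Kronecker products of A i with the multiplications by the basis of V is square and invertible, because
  the determinant is then a polynomial in V whose nonvanishing forces semistability.
  For such a V take the forms f i = sum of tau^(l^2) x^l over l congruent to i mod N + 1.  As tau tends to 0,
  its module, in suitably rescaled bases, tends to a staircase-shaped module with 0-1 entries.  Staircases are
  preserved by reflection, so they reduce to those with n at most N s (or s = 1), where each arrow is
  a partial injection of bases and the matrices A i can be found on a finite covering.\<close>

section \<open>Matrices with trivial kernel\<close>

text \<open>Why a determinant decides: with \<open>Q * s = P * n\<close> the matrix built from the
  \<open>A i\<close> is square, and restricted to W it maps a space of dimension Q dim W injectively
  into one of dimension P dim (V W). One invertible example settles all W at once, and invertibility
  is an open condition on V. Semistability of a general module of this dimension vector would not
  suffice, since multiplication by V gives a special family of modules; the example has to be a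
  limit of that family. Relations of a multiplication module need not form a multiplication module
  again, so the induction runs over staircases, a class that contains such a limit and is stable
  under reflection. \<open>Phi N\<close> records how reflection moves slopes. It inverts
  \<open>rho N\<close>, whose fixed point \<open>phi N\<close> attracts the iterates of 0. Slopes
  above \<open>phi N\<close> therefore climb until \<open>n \<le> N * s\<close>, nonzero iterates of
  0 end at 1 / N, that is \<open>n = (N + 1) * s\<close>, and the remaining ones fall below 1 / N,
  that is \<open>n > (N + 1) * s\<close>.\<close>

definition trivial_kernel :: "'a set \<Rightarrow> 'b set \<Rightarrow> ('b \<Rightarrow> 'a \<Rightarrow> complex) \<Rightarrow> bool" where
  "trivial_kernel C R M \<longleftrightarrow> (\<forall>v. (\<forall>r\<in>R. (\<Sum>c\<in>C. M r c * v c) = 0) \<longrightarrow> (\<forall>c\<in>C. v c = 0))"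

lemma trivial_kernelI:
  "(\<And>v c. (\<And>r. r \<in> R \<Longrightarrow> (\<Sum>c\<in>C. M r c * v c) = 0) \<Longrightarrow> c \<in> C \<Longrightarrow> v c = 0) \<Longrightarrow> trivial_kernel C R M"
  unfolding trivial_kernel_def by blast

lemma trivial_kernelD:
  "trivial_kernel C R M \<Longrightarrow> (\<And>r. r \<in> R \<Longrightarrow> (\<Sum>c\<in>C. M r c * v c) = 0) \<Longrightarrow> c \<in> C \<Longrightarrow> v c = 0"
  unfolding trivial_kernel_def by blast

lemma trivial_kernel_cong:
  "(\<And>r c. r \<in> R \<Longrightarrow> c \<in> C \<Longrightarrow> M r c = M' r c) \<Longrightarrow> trivial_kernel C R M = trivial_kernel C R M'"
  unfolding trivial_kernel_def by (simp cong: sum.cong)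

lemma trivial_kernel_scale:
  assumes "trivial_kernel C R M" "\<And>r. r \<in> R \<Longrightarrow> d r \<noteq> 0" "\<And>c. c \<in> C \<Longrightarrow> e c \<noteq> 0"
  shows "trivial_kernel C R (\<lambda>r c. d r * e c * M r c)"
proof (rule trivial_kernelI)
  fix v c assume v: "\<And>r. r \<in> R \<Longrightarrow> (\<Sum>c\<in>C. d r * e c * M r c * v c) = 0" and c: "c \<in> C"
  have "e c * v c = 0"
  proof (rule trivial_kernelD[OF assms(1) _ c])
    fix r assume r: "r \<in> R"
    have "d r * (\<Sum>c\<in>C. M r c * (e c * v c)) = 0"
      using v[OF r] by (simp add: sum_distrib_left algebra_simps)
    with assms(2)[OF r] show "(\<Sum>c\<in>C. M r c * (e c * v c)) = 0" by simp
  qed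
  with assms(3)[OF c] show "v c = 0" by simp
qed

lemma trivial_kernel_reindex:
  assumes "bij_betw g C' C" "bij_betw h R' R"
  shows "trivial_kernel C' R' (\<lambda>r c. M (h r) (g c)) \<longleftrightarrow> trivial_kernel C R M"
proof
  assume L: "trivial_kernel C' R' (\<lambda>r c. M (h r) (g c))"
  show "trivial_kernel C R M"
  proof (rule trivial_kernelI)
    fix v c assume v: "\<And>r. r \<in> R \<Longrightarrow> (\<Sum>c\<in>C. M r c * v c) = 0" and c: "c \<in> C"
    obtain c' where c': "c' \<in> C'" "c = g c'" using c assms(1) by (auto simp: bij_betw_def)
    have "(v \<circ> g) c' = 0"
    proof (rule trivial_kernelD[OF L _ c'(1)])
      fix r assume "r \<in> R'"
      then have "h r \<in> R" using assms(2) by (auto simp: bij_betw_def)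
      from v[OF this] show "(\<Sum>c\<in>C'. M (h r) (g c) * (v \<circ> g) c) = 0"
        using sum.reindex_bij_betw[OF assms(1), of "\<lambda>c. M (h r) c * v c"] by simp
    qed
    then show "v c = 0" by (simp add: c')
  qed
next
  assume L: "trivial_kernel C R M"
  show "trivial_kernel C' R' (\<lambda>r c. M (h r) (g c))"
  proof (rule trivial_kernelI)
    fix v c assume v: "\<And>r. r \<in> R' \<Longrightarrow> (\<Sum>c\<in>C'. M (h r) (g c) * v c) = 0" and c: "c \<in> C'"
    define u where "u = (\<lambda>c. v (the_inv_into C' g c))"
    have u: "u (g c) = v c" if "c \<in> C'" for c
      using that assms(1) by (simp add: u_def bij_betw_def the_inv_into_f_f)
    have "u (g c) = 0"
    proof (rule trivial_kernelD[OF L])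
      fix r assume "r \<in> R"
      then obtain r' where r': "r' \<in> R'" "r = h r'" using assms(2) by (auto simp: bij_betw_def)
      show "(\<Sum>c\<in>C. M r c * u c) = 0"
        using v[OF r'(1)] sum.reindex_bij_betw[OF assms(1), of "\<lambda>c. M r c * u c"]
        by (simp add: u r' cong: sum.cong)
      next show "g c \<in> C" using c assms(1) by (auto simp: bij_betw_def)
    qed
    then show "v c = 0" using u c by simp
  qed
qed

text \<open>Each equation costs at most one dimension: one member of the current family is used up
  as pivot, the others are corrected by multiples of it. Truncated subtraction makes the claim
  vacuous when there are at least as many rows as columns.\<close>

lemma independent_solutions:
  fixes M :: "'b \<Rightarrow> 'a \<Rightarrow> complex"
  assumes "finite R" "finite C"
  shows "\<exists>B :: nat \<Rightarrow> 'a \<Rightarrow> complex.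
    (\<forall>a < card C - card R. \<forall>r\<in>R. (\<Sum>c\<in>C. M r c * B a c) = 0) \<and>
    trivial_kernel {..<card C - card R} C (\<lambda>c a. B a c)"
  using assms(1)
proof (induction R)
  case empty
  obtain g where g: "bij_betw g {..<card C} C"
    using ex_bij_betw_nat_finite[OF assms(2)] by (auto simp: atLeast0LessThan)
  have "trivial_kernel {..<card C} C (\<lambda>c a. if c = g a then 1 else 0 :: complex)"
  proof (rule trivial_kernelI)
    fix v :: "nat \<Rightarrow> complex" and a
    assume v: "\<And>c. c \<in> C \<Longrightarrow> (\<Sum>a<card C. (if c = g a then 1 else 0) * v a) = 0" and a: "a \<in> {..<card C}"
    have "(\<Sum>a'<card C. (if g a = g a' then 1 else 0) * v a') = (\<Sum>a'<card C. if a' = a then v a' else 0)"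
      using g a by (intro sum.cong) (auto simp: bij_betw_def inj_on_def)
    with v[of "g a"] show "v a = 0" using g a by (auto simp: bij_betw_def)
  qed
  then show ?case by (auto intro!: exI[of _ "\<lambda>a c. if c = g a then 1 else 0"])
next
  case (insert r R)
  obtain B where B: "\<And>a r. a < card C - card R \<Longrightarrow> r \<in> R \<Longrightarrow> (\<Sum>c\<in>C. M r c * B a c) = 0"
    and tk: "trivial_kernel {..<card C - card R} C (\<lambda>c a. B a c)"
    using insert.IH by blast
  define d where "d = card C - card R"
  define l where "l a = (\<Sum>c\<in>C. M r c * B a c)" for a
  have d': "card C - card (insert r R) = d - 1" using insert by (simp add: d_def)
  \<comment> \<open>The pivot is a member on which the new equation fails; if there is none, the
    last member is dropped so that the count is still \<open>d - 1\<close>.\<close>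
  obtain p where p: "p \<le> d - 1" "(\<exists>a<d. l a \<noteq> 0) \<Longrightarrow> p < d \<and> l p \<noteq> 0" "\<not> (\<exists>a<d. l a \<noteq> 0) \<Longrightarrow> p = d - 1"
    by (metis Suc_pred' less_Suc_eq_le not_gr_zero less_nat_zero_code le_refl)
  define q where "q a = (if a < p then a else Suc a)" for a
  have q: "q a < d" "q a \<noteq> p" if "a < d - 1" for a using that p(1) by (auto simp: q_def)
  have qi: "inj_on q {..<d-1}" by (auto simp: q_def inj_on_def split: if_splits)
  have qim: "q ` {..<d-1} = {..<d} - {p}"
  proof
    show "{..<d} - {p} \<subseteq> q ` {..<d-1}"
    proof
      fix x assume x: "x \<in> {..<d} - {p}"
      show "x \<in> q ` {..<d-1}"
        by (rule image_eqI[of _ _ "if x < p then x else x - 1"]) (use x p(1) in \<open>auto simp: q_def\<close>)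
    qed
  qed (use q in auto)
  \<comment> \<open>Elimination of the pivot. Without a pivot \<open>l (q a) = 0\<close> and the
    correction vanishes.\<close>
  define B' where "B' a c = B (q a) c - l (q a) / l p * B p c" for a c
  have "(\<Sum>c\<in>C. M r' c * B' a c) = 0" if a: "a < d - 1" and r': "r' \<in> insert r R" for a r'
  proof -
    have e: "(\<Sum>c\<in>C. M r' c * B' a c) = (\<Sum>c\<in>C. M r' c * B (q a) c) - l (q a) / l p * (\<Sum>c\<in>C. M r' c * B p c)"
      by (simp add: B'_def algebra_simps sum_subtractf sum_distrib_left)
    show ?thesis
    proof (cases "r' = r")
      case True
      then show ?thesis unfolding e using p(2) q(1)[OF a] by (auto simp flip: l_def)
    next
      case False
      then have "r' \<in> R" using r' by simp
      moreover have "p < d" using p(1) a by linarith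
      ultimately show ?thesis unfolding e using B q(1)[OF a] by (simp add: d_def)
    qed
  qed
  moreover have "trivial_kernel {..<d-1} C (\<lambda>c a. B' a c)"
  proof (rule trivial_kernelI)
    fix v a assume v: "\<And>c. c \<in> C \<Longrightarrow> (\<Sum>a<d-1. B' a c * v a) = 0" and a: "a \<in> {..<d-1}"
    \<comment> \<open>A vanishing combination of the corrected members is one of the old members,
      the coefficient at \<open>p\<close> collecting the corrections.\<close>
    define u where "u x = (if x = p then - (\<Sum>a<d-1. l (q a) / l p * v a) else v (the_inv_into {..<d-1} q x))" for x
    have uq: "u (q a) = v a" if "a < d - 1" for a
      using that q(2)[OF that] the_inv_into_f_f[OF qi, of a] by (simp add: u_def)
    have "u (q a) = 0"
    proof (rule trivial_kernelD[OF tk])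
      fix c assume c: "c \<in> C"
      have pd: "p \<in> {..<d}" using a p(1) by auto
      have "(\<Sum>x<d. B x c * u x) = B p c * u p + (\<Sum>x\<in>{..<d}-{p}. B x c * u x)"
        using pd by (simp add: sum.remove)
      also have "(\<Sum>x\<in>{..<d}-{p}. B x c * u x) = (\<Sum>a<d-1. B (q a) c * v a)"
        unfolding qim[symmetric] by (subst sum.reindex[OF qi]) (simp add: uq)
      also have "B p c * u p = (\<Sum>a<d-1. - (l (q a) / l p * B p c * v a))"
        by (simp add: u_def sum_distrib_left sum_negf mult_ac)
      finally show "(\<Sum>x<card C - card R. B x c * u x) = 0"
        using v[OF c] by (simp add: d_def[symmetric] B'_def algebra_simps sum.distrib sum_subtractf sum_negf)
    next
      show "q a \<in> {..<card C - card R}" using q(1) a by (simp add: d_def)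
    qed
    then show "v a = 0" using uq a by simp
  qed
  ultimately show ?case unfolding d' by blast
qed

lemma trivial_kernel_card_le:
  assumes "trivial_kernel C R M" "finite C" "finite R"
  shows "card C \<le> card R"
proof (rule ccontr)
  assume "\<not> ?thesis"
  then have d: "0 < card C - card R" by simp
  obtain B :: "nat \<Rightarrow> _ \<Rightarrow> complex" where B: "\<And>r. r \<in> R \<Longrightarrow> (\<Sum>c\<in>C. M r c * B 0 c) = 0"
    and tk: "trivial_kernel {..<card C - card R} C (\<lambda>c a. B a c)"
    using independent_solutions[OF assms(3,2), of M] d by blast
  have z: "B 0 c = 0" if "c \<in> C" for c using trivial_kernelD[OF assms(1) B that] .
  have "(\<Sum>a<card C - card R. B a c * (if a = 0 then 1 else 0)) = 0" if "c \<in> C" for c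
    using z[OF that] by (intro sum.neutral) auto
  from trivial_kernelD[OF tk this, of 0] d show False by auto
qed

text \<open>P stands for polynomials in one variable or for polynomial functions on affine space.\<close>

lemma determinant_in_class:
  fixes M :: "'x \<Rightarrow> 'b \<Rightarrow> 'a \<Rightarrow> complex"
  assumes fin: "finite C" "finite R" "card C = card R"
    and const: "\<And>c. P (\<lambda>x. c)"
    and add: "\<And>f g. P f \<Longrightarrow> P g \<Longrightarrow> P (\<lambda>x. f x + g x)"
    and mult: "\<And>f g. P f \<Longrightarrow> P g \<Longrightarrow> P (\<lambda>x. f x * g x)"
    and M: "\<And>r c. r \<in> R \<Longrightarrow> c \<in> C \<Longrightarrow> P (\<lambda>x. M x r c)"
  shows "\<exists>D. P D \<and> (\<forall>x. D x \<noteq> 0 \<longleftrightarrow> trivial_kernel C R (M x))"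
proof -
  define n where "n = card C"
  obtain g where g: "bij_betw g {..<n} C"
    using ex_bij_betw_nat_finite[OF fin(1)] by (auto simp: atLeast0LessThan n_def)
  obtain h where h: "bij_betw h {..<n} R"
    using ex_bij_betw_nat_finite[OF fin(2)] fin(3) by (auto simp: atLeast0LessThan n_def)
  have psum: "P (\<lambda>x. \<Sum>i\<in>I. f i x)" if "finite I" "\<And>i. i \<in> I \<Longrightarrow> P (f i)" for I :: "(nat \<Rightarrow> nat) set" and f
    using that by (induction I) (auto intro: const add)
  have pprod: "P (\<lambda>x. \<Prod>i\<in>I. f i x)" if "finite I" "\<And>i. i \<in> I \<Longrightarrow> P (f i)" for I :: "nat set" and f
    using that by (induction I) (auto intro: const mult)
  define A where "A x = mat n n (\<lambda>(i,j). M x (h i) (g j))" for x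
  have A: "A x \<in> carrier_mat n n" for x by (simp add: A_def)
  have "P (\<lambda>x. det (A x))"
  proof -
    \<comment> \<open>Leibniz's formula uses only constants, sums and products, which is all that
      \<open>P\<close> is assumed to be closed under.\<close>
    have "(\<lambda>x. det (A x)) = (\<lambda>x. \<Sum>p\<in>{p. p permutes {0..<n}}. signof p * (\<Prod>i = 0..<n. M x (h i) (g (p i))))"
      unfolding det_def'[OF A]
      by (intro ext sum.cong arg_cong2[of _ _ _ _ "(*)"] prod.cong refl) (auto simp: A_def permutes_in_image)
    moreover have "P \<dots>"
      using g h by (intro psum mult const pprod M) (auto simp: finite_permutations bij_betw_def dest: permutes_in_image)
    ultimately show ?thesis by simp
  qed
  moreover have "det (A x) \<noteq> 0 \<longleftrightarrow> trivial_kernel C R (M x)" for x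
  proof -
    have e: "(A x *\<^sub>v v = 0\<^sub>v n) \<longleftrightarrow> (\<forall>i<n. (\<Sum>j<n. M x (h i) (g j) * v $ j) = 0)" if "v \<in> carrier_vec n" for v
      using that by (auto simp: A_def vec_eq_iff scalar_prod_def atLeast0LessThan)
    have "det (A x) = 0 \<longleftrightarrow> \<not> trivial_kernel {..<n} {..<n} (\<lambda>i j. M x (h i) (g j))"
    proof
      assume "det (A x) = 0"
      then obtain v where v: "v \<in> carrier_vec n" "v \<noteq> 0\<^sub>v n" "A x *\<^sub>v v = 0\<^sub>v n"
        using det_0_iff_vec_prod_zero_field[OF A] by blast
      then show "\<not> trivial_kernel {..<n} {..<n} (\<lambda>i j. M x (h i) (g j))"
        using e[OF v(1)] by (auto simp: trivial_kernel_def vec_eq_iff)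
    next
      assume "\<not> trivial_kernel {..<n} {..<n} (\<lambda>i j. M x (h i) (g j))"
      then obtain v i where v: "\<forall>i<n. (\<Sum>j<n. M x (h i) (g j) * v j) = 0" "i < n" "v i \<noteq> 0"
        by (auto simp: trivial_kernel_def)
      have "(\<Sum>j<n. M x (h i) (g j) * vec n v $ j) = (\<Sum>j<n. M x (h i) (g j) * v j)" for i
        by (intro sum.cong) auto
      have "A x *\<^sub>v vec n v = 0\<^sub>v n" using v by (subst e) simp_all
      moreover have "vec n v \<noteq> 0\<^sub>v n" using v by (auto simp: vec_eq_iff)
      ultimately show "det (A x) = 0"
        using det_0_iff_vec_prod_zero_field[OF A] by (meson vec_carrier)
    qed
    then show ?thesis using trivial_kernel_reindex[OF g h, of "M x"] by blast
  qed
  ultimately show ?thesis by blast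
qed

section \<open>Simultaneous generic choices along lines\<close>

lemma poly_trivial_kernel:
  fixes X :: "complex \<Rightarrow> 'b \<Rightarrow> 'a \<Rightarrow> complex"
  assumes "finite C" "finite R" "card C = card R"
    and "\<And>r c. r \<in> R \<Longrightarrow> c \<in> C \<Longrightarrow> \<exists>p. \<forall>t. X t r c = poly p t"
  shows "\<exists>p. \<forall>t. poly p t \<noteq> 0 \<longleftrightarrow> trivial_kernel C R (X t)"
proof -
  have "\<exists>D. (\<exists>p. \<forall>t. D t = poly p t) \<and> (\<forall>t. D t \<noteq> 0 \<longleftrightarrow> trivial_kernel C R (X t))"
  proof (rule determinant_in_class[OF assms(1-3)])
    show "\<exists>p. \<forall>t. c = poly p t" for c :: complex by (rule exI[of _ "[:c:]"]) simp
    show "\<exists>p. \<forall>t. f t + g t = poly p t"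
      if "\<exists>p. \<forall>t. f t = poly p t" "\<exists>p. \<forall>t. g t = poly p t" for f g :: "complex \<Rightarrow> complex"
      using that by (metis poly_add)
    show "\<exists>p. \<forall>t. f t * g t = poly p t"
      if "\<exists>p. \<forall>t. f t = poly p t" "\<exists>p. \<forall>t. g t = poly p t" for f g :: "complex \<Rightarrow> complex"
      using that by (metis poly_mult)
  qed (use assms(4) in auto)
  then show ?thesis by metis
qed

lemma exists_common_nonroot:
  fixes p :: "'g \<Rightarrow> complex poly"
  assumes "finite G" "\<And>g. g \<in> G \<Longrightarrow> \<exists>t. poly (p g) t \<noteq> 0" "finite E"
  shows "\<exists>t. t \<notin> E \<and> (\<forall>g\<in>G. poly (p g) t \<noteq> 0)"
proof -
  have "finite (E \<union> (\<Union>g\<in>G. {t. poly (p g) t = 0}))"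
  proof (intro finite_UnI finite_UN_I assms poly_roots_finite)
    show "p g \<noteq> 0" if "g \<in> G" for g using assms(2)[OF that] by auto
  qed
  then obtain t where "t \<notin> E \<union> (\<Union>g\<in>G. {t. poly (p g) t = 0})"
    using ex_new_if_finite infinite_UNIV_char_0 by blast
  then show ?thesis by auto
qed

text \<open>Two good parameters are joined by a line; on it every determinant is a polynomial in t
  with a nonzero value, so all but finitely many t serve all of them. The assumption
  \<open>line\<close> speaks of lines only, so the parameters may be indexed by any type.\<close>

lemma common_trivial_kernel:
  fixes M :: "'g \<Rightarrow> ('i \<Rightarrow> complex) \<Rightarrow> 'b \<Rightarrow> 'a \<Rightarrow> complex"
  assumes "finite G" and C: "finite C" "finite R" "card C = card R"
    and line: "\<And>g \<alpha> \<beta> r c. g \<in> G \<Longrightarrow> r \<in> R \<Longrightarrow> c \<in> C \<Longrightarrow>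
      \<exists>p. \<forall>t. M g (\<lambda>i. \<alpha> i + t * (\<beta> i - \<alpha> i)) r c = poly p t"
    and ex: "\<And>g. g \<in> G \<Longrightarrow> \<exists>\<alpha>. trivial_kernel C R (M g \<alpha>)"
  shows "\<exists>\<alpha>. \<forall>g\<in>G. trivial_kernel C R (M g \<alpha>)"
  using assms(1) line ex
proof (induction G)
  case (insert g G)
  obtain \<alpha> where \<alpha>: "\<forall>g\<in>G. trivial_kernel C R (M g \<alpha>)"
    using insert.IH[OF insert.prems(1) insert.prems(2)] by blast
  obtain \<beta> where \<beta>: "trivial_kernel C R (M g \<beta>)" using insert.prems(2)[of g] by blast
  define L where "L t = (\<lambda>i. \<alpha> i + t * (\<beta> i - \<alpha> i))" for t
  have "\<forall>h\<in>insert g G. \<exists>p. \<forall>t. poly p t \<noteq> 0 \<longleftrightarrow> trivial_kernel C R (M h (L t))"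
    unfolding L_def using insert.prems(1) by (intro ballI poly_trivial_kernel C) auto
  then obtain p where p: "\<And>h t. h \<in> insert g G \<Longrightarrow> poly (p h) t \<noteq> 0 \<longleftrightarrow> trivial_kernel C R (M h (L t))"
    by metis
  have L: "L 0 = \<alpha>" "L 1 = \<beta>" by (auto simp: L_def)
  have "\<exists>t. poly (p h) t \<noteq> 0" if "h \<in> insert g G" for h
    using p[OF that] \<alpha> \<beta> that L by (metis insertE)
  then obtain t where "\<forall>h\<in>insert g G. poly (p h) t \<noteq> 0"
    using exists_common_nonroot[of "insert g G" p "{}"] insert.hyps by blast
  then show ?case using p by blast
qed auto

lemma polyfun_on_line:
  "polyfun n F \<Longrightarrow> \<exists>p. \<forall>t. F (\<lambda>i. x i + t * (y i - x i)) = poly p t"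
proof (induction rule: polyfun.induct)
  case (const c)
  show ?case by (rule exI[of _ "[:c:]"]) simp
next
  case (var i)
  show ?case by (rule exI[of _ "[:x i, y i - x i:]"]) simp
next
  case (add F G)
  then show ?case by (metis poly_add)
next
  case (mult F G)
  then show ?case by (metis poly_mult)
qed

text \<open>Irreducibility of affine space, seen on the line from \<open>x\<close> to
  \<open>y\<close>.\<close>

lemma polyfun_common_nonzero:
  assumes "polyfun n F" "polyfun n G" "F x \<noteq> 0" "G y \<noteq> 0"
  shows "\<exists>z. F z \<noteq> 0 \<and> G z \<noteq> 0"
proof -
  obtain p where p: "\<And>t. F (\<lambda>i. x i + t * (y i - x i)) = poly p t"
    using polyfun_on_line[OF assms(1)] by blast
  obtain q where q: "\<And>t. G (\<lambda>i. x i + t * (y i - x i)) = poly q t"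
    using polyfun_on_line[OF assms(2)] by blast
  have "poly p 0 \<noteq> 0" "poly q 1 \<noteq> 0" using assms p[of 0] q[of 1] by auto
  then have "\<exists>t. poly (if b then p else q) t \<noteq> 0" for b by (cases b) auto
  then obtain t where "\<forall>b\<in>UNIV. poly (if b then p else q) t \<noteq> 0"
    using exists_common_nonroot[of "UNIV :: bool set" "\<lambda>b. if b then p else q" "{}"] by auto
  from this[THEN bspec, of True] this[THEN bspec, of False] have "poly p t \<noteq> 0" "poly q t \<noteq> 0" by auto
  then show ?thesis using p q by metis
qed

lemma polyfun_trivial_kernel:
  assumes "finite C" "finite R" "card C = card R"
    and "\<And>r c. r \<in> R \<Longrightarrow> c \<in> C \<Longrightarrow> polyfun n (\<lambda>x. M x r c)"
  shows "\<exists>D. polyfun n D \<and> (\<forall>x. D x \<noteq> 0 \<longleftrightarrow> trivial_kernel C R (M x))"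
  by (rule determinant_in_class[OF assms(1-3)]) (auto intro: polyfun.intros assms(4))

lemma polyfun_sum:
  "finite I \<Longrightarrow> (\<And>i. i \<in> I \<Longrightarrow> polyfun n (f i)) \<Longrightarrow> polyfun n (\<lambda>x. \<Sum>i\<in>I. f i x)"
  by (induction I rule: finite_induct) (auto intro: polyfun.intros)

text \<open>A module is a family f of matrices, f i k j being the entry of the i-th arrow in row k < n and
  column j < s.\<close>

definition cert :: "nat \<Rightarrow> nat \<Rightarrow> nat \<Rightarrow> (nat \<Rightarrow> nat \<Rightarrow> nat \<Rightarrow> complex) \<Rightarrow> bool" where
  "cert N s n f \<longleftrightarrow> (\<exists>P Q (A :: nat \<Rightarrow> nat \<Rightarrow> nat \<Rightarrow> complex). P > 0 \<and> Q * s = P * n \<and>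
     trivial_kernel ({..<s} \<times> {..<Q}) ({..<n} \<times> {..<P}) (\<lambda>(k,z) (j,x). \<Sum>i\<le>N. f i k j * A i z x))"

lemma certI_nat:
  fixes A :: "nat \<Rightarrow> nat \<Rightarrow> nat \<Rightarrow> complex"
  assumes "P > 0" "Q * s = P * n"
    "trivial_kernel ({..<s} \<times> {..<Q}) ({..<n} \<times> {..<P}) (\<lambda>(k,z) (j,x). \<Sum>i\<le>N. f i k j * A i z x)"
  shows "cert N s n f"
  unfolding cert_def by (rule exI[of _ P], rule exI[of _ Q], rule exI[of _ A], intro conjI assms)

text \<open>Arbitrary finite index sets, because the covering in the base case is indexed by
  permutations.\<close>

lemma certI:
  assumes "finite Z" "finite X" "Z \<noteq> {}" "card X * s = card Z * n"
    and "trivial_kernel ({..<s} \<times> X) ({..<n} \<times> Z) (\<lambda>(k,z) (j,x). \<Sum>i\<le>N. f i k j * A i z x)"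
  shows "cert N s n f"
proof -
  obtain g where g: "bij_betw g {..<card X} X"
    using ex_bij_betw_nat_finite[OF assms(2)] by (auto simp: atLeast0LessThan)
  obtain h where h: "bij_betw h {..<card Z} Z"
    using ex_bij_betw_nat_finite[OF assms(1)] by (auto simp: atLeast0LessThan)
  have 1: "bij_betw (map_prod id g) ({..<s} \<times> {..<card X}) ({..<s} \<times> X)"
    and 2: "bij_betw (map_prod id h) ({..<n} \<times> {..<card Z}) ({..<n} \<times> Z)"
    using g h unfolding bij_betw_def by (simp_all add: map_prod_inj_on map_prod_surj_on)
  have 3: "trivial_kernel ({..<s} \<times> {..<card X}) ({..<n} \<times> {..<card Z})
     (\<lambda>(k,z) (j,x). \<Sum>i\<le>N. f i k j * A i (h z) (g x))"
    using assms(5) unfolding trivial_kernel_reindex[OF 1 2, symmetric]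
    by (rule trivial_kernel_cong[THEN iffD1, rotated]) auto
  have "card Z > 0" using assms(1,3) by (simp add: card_gt_0_iff)
  from certI_nat[OF this assms(4) 3] show ?thesis .
qed

lemma cert_scale:
  assumes "cert N s n f" "\<And>k. k < n \<Longrightarrow> d k \<noteq> 0"
  shows "cert N s n (\<lambda>i k j. d k * f i k j)"
proof -
  obtain P Q and A :: "nat \<Rightarrow> nat \<Rightarrow> nat \<Rightarrow> complex" where *: "P > 0" "Q * s = P * n"
    "trivial_kernel ({..<s} \<times> {..<Q}) ({..<n} \<times> {..<P}) (\<lambda>(k,z) (j,x). \<Sum>i\<le>N. f i k j * A i z x)"
    using assms(1) unfolding cert_def by blast
  have "trivial_kernel ({..<s} \<times> {..<Q}) ({..<n} \<times> {..<P})
    (\<lambda>r c. d (fst r) * 1 * (\<lambda>(k,z) (j,x). \<Sum>i\<le>N. f i k j * A i z x) r c)"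
    by (rule trivial_kernel_scale[OF *(3)]) (use assms(2) in auto)
  then have "trivial_kernel ({..<s} \<times> {..<Q}) ({..<n} \<times> {..<P})
    (\<lambda>(k,z) (j,x). \<Sum>i\<le>N. d k * f i k j * A i z x)"
    by (rule trivial_kernel_cong[THEN iffD1, rotated]) (auto simp: sum_distrib_left mult.assoc)
  then show ?thesis by (rule certI_nat[OF *(1,2)])
qed

text \<open>The reflection functor: f' is the module of relations of f, and the matrices certifying f
  are a basis of the kernel of those certifying f'.\<close>

lemma cert_reflect:
  assumes "cert N s' s f'" and n: "s' + n = (N + 1) * s" "s > 0"
    and ker: "\<And>w :: nat \<Rightarrow> nat \<Rightarrow> complex. (\<And>k. k < n \<Longrightarrow> (\<Sum>i\<le>N. \<Sum>j<s. f i k j * w j i) = 0) \<Longrightarrow>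
       \<exists>y. \<forall>j<s. \<forall>i\<le>N. w j i = (\<Sum>m<s'. f' i j m * y m)"
  shows "cert N s n f"
proof -
  obtain P' Q' and A' :: "nat \<Rightarrow> nat \<Rightarrow> nat \<Rightarrow> complex" where A': "P' > 0" "Q' * s' = P' * s" and
    tk: "trivial_kernel ({..<s'} \<times> {..<Q'}) ({..<s} \<times> {..<P'}) (\<lambda>(k,z) (j,x). \<Sum>i\<le>N. f' i k j * A' i z x)"
    using assms(1) unfolding cert_def by blast
  \<comment> \<open>The blocks \<open>A' i\<close> placed side by side form a matrix with
    \<open>P'\<close> rows and \<open>(N + 1) * Q'\<close> columns, so its kernel contains at least
    this many independent vectors \<open>B a\<close>. Their slices over i are the new
    matrices.\<close>
  define Q where "Q = (N + 1) * Q' - P'"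
  have cQ: "card ({..N} \<times> {..<Q'}) - card {..<P'} = Q" by (simp add: Q_def)
  obtain B where B: "\<And>a z. a < Q \<Longrightarrow> z < P' \<Longrightarrow> (\<Sum>(i,x)\<in>{..N} \<times> {..<Q'}. A' i z x * B a (i,x)) = 0"
    and tkB: "trivial_kernel {..<Q} ({..N} \<times> {..<Q'}) (\<lambda>c a. B a c)"
    using independent_solutions[of "{..<P'}" "{..N} \<times> {..<Q'}" "\<lambda>z (i,x). A' i z x"]
    unfolding cQ by (auto simp: case_prod_beta)
  \<comment> \<open>Squareness is inherited: \<open>Q'\<close> and \<open>Q\<close> now play the
    roles of \<open>P\<close> and \<open>Q\<close>.\<close>
  have "Q' * n + P' * s = (N + 1) * Q' * s"
    using n(1) A'(2) by (metis add_mult_distrib2 add.commute mult.assoc mult.left_commute)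
  then have 1: "Q * s = Q' * n" unfolding Q_def diff_mult_distrib by linarith
  have "P' * s > 0" using A'(1) n(2) by simp
  then have 2: "Q' > 0" using A'(2) by (metis gr0I mult_0)
  have 3: "trivial_kernel ({..<s} \<times> {..<Q}) ({..<n} \<times> {..<Q'}) (\<lambda>(k,z) (j,x). \<Sum>i\<le>N. f i k j * B x (i,z))"
  proof (rule trivial_kernelI)
    fix v :: "nat \<times> nat \<Rightarrow> complex" and c0
    assume v: "\<And>r. r \<in> {..<n} \<times> {..<Q'} \<Longrightarrow>
        (\<Sum>c\<in>{..<s} \<times> {..<Q}. (\<lambda>(k,z) (j,x). \<Sum>i\<le>N. f i k j * B x (i,z)) r c * v c) = 0"
      and "c0 \<in> {..<s} \<times> {..<Q}"
    then obtain j0 a0 where c0: "c0 = (j0,a0)" and j0: "j0 < s" and a0: "a0 < Q" by auto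
    \<comment> \<open>For each \<open>x\<close> the contraction of \<open>v\<close> with
      \<open>B\<close> is a relation of \<open>f\<close>, hence comes from a vector \<open>y\<close>
      on the columns of \<open>f'\<close>.\<close>
    define w where "w x j i = (\<Sum>a<Q. B a (i,x) * v (j,a))" for x j i
    have "\<exists>y. \<forall>j<s. \<forall>i\<le>N. w x j i = (\<Sum>m<s'. f' i j m * y m)" if x: "x < Q'" for x
    proof (rule ker)
      fix k assume k: "k < n"
      have "0 = (\<Sum>(j,a)\<in>{..<s} \<times> {..<Q}. (\<Sum>i\<le>N. f i k j * B a (i,x)) * v (j,a))"
        using v[of "(k,x)"] k x by (simp add: case_prod_beta)
      also have "\<dots> = (\<Sum>j<s. \<Sum>a<Q. \<Sum>i\<le>N. f i k j * B a (i,x) * v (j,a))"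
        by (simp add: sum.cartesian_product[symmetric] sum_distrib_right)
      also have "\<dots> = (\<Sum>j<s. \<Sum>i\<le>N. f i k j * w x j i)"
        unfolding w_def sum_distrib_left by (subst (2) sum.swap) (simp add: mult.assoc)
      also have "\<dots> = (\<Sum>i\<le>N. \<Sum>j<s. f i k j * w x j i)" by (rule sum.swap)
      finally show "(\<Sum>i\<le>N. \<Sum>j<s. f i k j * w x j i) = 0" by simp
    qed
    then obtain y where y: "\<And>x j i. x < Q' \<Longrightarrow> j < s \<Longrightarrow> i \<le> N \<Longrightarrow> w x j i = (\<Sum>m<s'. f' i j m * y x m)"
      by metis
    \<comment> \<open>\<open>A'\<close> annihilates \<open>B\<close>, so \<open>y\<close> lies in
      the kernel of the certificate of \<open>f'\<close>. Then \<open>w\<close> vanishes, and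
      independence of \<open>B\<close> gives \<open>v = 0\<close>.\<close>
    have y0: "y x m = 0" if "x < Q'" "m < s'" for x m
    proof -
      have "(\<lambda>(m,x). y x m) (m,x) = 0"
      proof (rule trivial_kernelD[OF tk, of "\<lambda>(m,x). y x m" "(m,x)"])
        fix r assume "r \<in> {..<s} \<times> {..<P'}"
        then obtain j z where r: "r = (j,z)" "j < s" "z < P'" by auto
        have "(\<Sum>(m,x)\<in>{..<s'} \<times> {..<Q'}. (\<Sum>i\<le>N. f' i j m * A' i z x) * y x m)
          = (\<Sum>m<s'. \<Sum>x<Q'. \<Sum>i\<le>N. A' i z x * (f' i j m * y x m))"
          unfolding sum.cartesian_product[symmetric] sum_distrib_right
          by (intro sum.cong refl) (simp only: mult_ac)
        also have "\<dots> = (\<Sum>x<Q'. \<Sum>i\<le>N. A' i z x * (\<Sum>m<s'. f' i j m * y x m))"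
          unfolding sum_distrib_left by (subst sum.swap) (rule sum.cong[OF refl], rule sum.swap)
        also have "\<dots> = (\<Sum>x<Q'. \<Sum>i\<le>N. \<Sum>a<Q. A' i z x * B a (i,x) * v (j,a))"
          by (intro sum.cong refl) (simp add: y[symmetric] r w_def sum_distrib_left mult.assoc)
        also have "\<dots> = (\<Sum>i\<le>N. \<Sum>x<Q'. \<Sum>a<Q. A' i z x * B a (i,x) * v (j,a))"
          by (rule sum.swap)
        also have "\<dots> = (\<Sum>c\<in>{..N} \<times> {..<Q'}. \<Sum>a<Q. A' (fst c) z (snd c) * B a c * v (j,a))"
          by (subst sum.cartesian_product) (intro sum.cong refl, auto)
        also have "\<dots> = (\<Sum>a<Q. (\<Sum>c\<in>{..N} \<times> {..<Q'}. A' (fst c) z (snd c) * B a c) * v (j,a))"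
          unfolding sum_distrib_right by (rule sum.swap)
        also have "\<dots> = 0"
          using B r(3) by (intro sum.neutral) (simp add: case_prod_beta)
        finally show "(\<Sum>c\<in>{..<s'} \<times> {..<Q'}. (\<lambda>(k,z) (j,x). \<Sum>i\<le>N. f' i k j * A' i z x) r c * (\<lambda>(m,x). y x m) c) = 0"
          by (simp only: r case_prod_unfold fst_conv snd_conv)
      next
        show "(m,x) \<in> {..<s'} \<times> {..<Q'}" using that by simp
      qed
      then show ?thesis by simp
    qed
    show "v c0 = 0" unfolding c0
    proof (rule trivial_kernelD[OF tkB, of "\<lambda>a. v (j0,a)" a0])
      fix c assume "c \<in> {..N} \<times> {..<Q'}"
      then obtain i x where c: "c = (i,x)" "i \<le> N" "x < Q'" by auto
      have "w x j0 i = 0" using y[OF c(3) j0 c(2)] y0[OF c(3)] by simp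
      then show "(\<Sum>a<Q. B a c * v (j0,a)) = 0" by (simp add: w_def c)
    next
      show "a0 \<in> {..<Q}" using a0 by simp
    qed
  qed
  show ?thesis by (rule certI_nat[OF 2 1 3])
qed

section \<open>Staircase modules\<close>

text \<open>The half-open intervals from j n to (j + 1) n and from k s to (k + 1) s overlap.  For coprime s and n
  these pairs form a lattice path.\<close>

definition edge :: "nat \<Rightarrow> nat \<Rightarrow> nat \<Rightarrow> nat \<Rightarrow> bool" where
  "edge s n j k \<longleftrightarrow> k * s < (j + 1) * n \<and> j * n < (k + 1) * s"

text \<open>Integer coefficients because reflection produces negative ones. With \<open>a\<close>
  and \<open>b\<close> equal to 1 or -1, any N + 1 consecutive edges at a vertex have different
  colours, which makes a colour a partial injection.\<close>

definition colour :: "nat \<Rightarrow> int \<Rightarrow> int \<Rightarrow> int \<Rightarrow> nat \<Rightarrow> nat \<Rightarrow> nat" where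
  "colour N a b c j k = nat ((a * int k + b * int j + c) mod (int N + 1))"

definition stair :: "nat \<Rightarrow> nat \<Rightarrow> nat \<Rightarrow> int \<Rightarrow> int \<Rightarrow> int \<Rightarrow> nat \<Rightarrow> nat \<Rightarrow> nat \<Rightarrow> complex" where
  "stair N s n a b c i k j = (if edge s n j k \<and> i = colour N a b c j k then 1 else 0)"

section \<open>Colours and the geometry of the path\<close>

lemma colour_le: "colour N a b c j k \<le> N"
proof -
  have "(a * int k + b * int j + c) mod (int N + 1) < int N + 1" by (rule pos_mod_bound) simp
  then show ?thesis by (simp add: colour_def nat_le_iff)
qed

lemma colour_eq_iff:
  "colour N a b c j k = colour N a' b' c' j' k' \<longleftrightarrow>
     (int N + 1) dvd (a * int k + b * int j + c) - (a' * int k' + b' * int j' + c')"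
proof -
  have "(a * int k + b * int j + c) mod (int N + 1) \<ge> 0" "(a' * int k' + b' * int j' + c') mod (int N + 1) \<ge> 0"
    by (auto intro!: pos_mod_sign)
  then show ?thesis by (simp add: colour_def eq_nat_nat_iff mod_eq_dvd_iff)
qed

lemma eq_0_if_dvd_small: "(int N + 1) dvd d \<Longrightarrow> \<bar>d\<bar> \<le> int N \<Longrightarrow> d = 0"
  using zdvd_not_zless[of "\<bar>d\<bar>" "int N + 1"] by (cases "d = 0") auto

lemma colour_inj_right:
  assumes "\<bar>a\<bar> = 1" "colour N a b c j k = colour N a b c j k'" "k \<le> k' + N" "k' \<le> k + N"
  shows "k = k'"
proof -
  have "(int N + 1) dvd a * (int k - int k')"
    using assms(2) by (simp add: colour_eq_iff algebra_simps)
  moreover have "a = 1 \<or> a = -1" using assms(1) by auto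
  ultimately have "(int N + 1) dvd int k - int k'" by (metis dvd_minus_iff mult_1 mult_minus1)
  then show ?thesis using eq_0_if_dvd_small[of N "int k - int k'"] assms(3,4) by auto
qed

lemma colour_inj_left:
  assumes "\<bar>b\<bar> = 1" "colour N a b c j k = colour N a b c j' k" "j \<le> j' + N" "j' \<le> j + N"
  shows "j = j'"
  using colour_inj_right[of b N a c k j j'] assms by (simp add: colour_def add_ac)

lemma sum_stair:
  "(\<Sum>i\<le>N. stair N s n a b c i k j * g i) = (if edge s n j k then g (colour N a b c j k) else 0)"
proof -
  have "(\<Sum>i\<le>N. stair N s n a b c i k j * g i)
      = (\<Sum>i\<le>N. if i = colour N a b c j k then (if edge s n j k then g i else 0) else 0)"
    by (intro sum.cong) (auto simp: stair_def)
  then show ?thesis using colour_le by simp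
qed

text \<open>Coprimality keeps the boundary \<open>j * n\<close> off the multiples of s. It lies
  strictly inside one row interval, whose row is the corner joining the columns j - 1 and j.\<close>

lemma corner_strict:
  fixes s n j :: nat
  assumes "coprime s n" "0 < j" "j < s"
  shows "j * n div s * s < j * n" "j * n < (j * n div s + 1) * s" "j * n div s < n"
proof -
  have "s > 0" using assms(2,3) by linarith
  then show "j * n < (j * n div s + 1) * s"
    using dividend_less_div_times[of s "j * n"] by (simp add: algebra_simps)
  have "\<not> s dvd j * n"
    using assms by (metis coprime_dvd_mult_left_iff nat_dvd_not_less)
  then show "j * n div s * s < j * n"
    by (metis div_times_less_eq_dividend dvd_triv_right le_neq_implies_less)
  then have "j * n div s * s < s * n" using assms(3)
    by (meson less_le_trans less_imp_le_nat mult_le_mono1)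
  then show "j * n div s < n" by (metis mult.commute mult_less_cancel2)
qed

lemma edge_corner:
  assumes "coprime s n" "Suc j < s"
  shows "edge s n j (Suc j * n div s)" "edge s n (Suc j) (Suc j * n div s)"
  using corner_strict[OF assms(1) _ assms(2)] by (auto simp: edge_def)

text \<open>Since \<open>s \<le> n\<close>, a row interval has at most one column boundary in its
  interior. Row k meets the column containing its left end and, if there is such a boundary, the
  next column; k is then the corner of that boundary.\<close>

lemma edge_cases:
  assumes "edge s n j k" "s \<le> n" "s > 0"
  shows "j = k * s div n \<or> (j = Suc (k * s div n) \<and> k = j * n div s)"
proof -
  define j0 where "j0 = k * s div n"
  have n: "n > 0" using assms by simp
  have 1: "j0 < j + 1" unfolding j0_def using assms(1) n by (simp add: edge_def div_less_iff_less_mult)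
  have 2: "k * s < (j0 + 1) * n" unfolding j0_def
    using dividend_less_div_times[OF n, of "k * s"] by (simp add: algebra_simps)
  have "j * n < (j0 + 2) * n" using assms(1,2) 2 unfolding edge_def by (simp add: algebra_simps)
  then have 3: "j < j0 + 2" by (metis mult_less_cancel2)
  show ?thesis
  proof (cases "j = j0")
    case False
    then have j: "j = Suc j0" using 1 3 by simp
    have "k * s \<le> j * n" using 2 j by simp
    moreover have "j * n < Suc k * s" using assms(1) by (simp add: edge_def)
    ultimately have "j * n div s = k"
      by (metis div_nat_eqI mult.commute)
    then show ?thesis using j by (simp add: j0_def)
  qed (simp add: j0_def)
qed

lemma partial_injection_extends:
  assumes "finite U" "inj_on f J" "J \<subseteq> U" "f ` J \<subseteq> U"
  shows "\<exists>p. p permutes U \<and> (\<forall>j\<in>J. p j = f j)"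
proof -
  have "card (U - J) = card (U - f ` J)"
    using assms by (simp add: card_Diff_subset card_image finite_subset)
  then obtain h where h: "bij_betw h (U - J) (U - f ` J)"
    using assms(1) by (metis finite_Diff finite_same_card_bij)
  define p where "p x = (if x \<in> J then f x else if x \<in> U then h x else x)" for x
  have "bij_betw p J (f ` J)"
    using assms(2) by (intro bij_betw_cong[THEN iffD1, OF _ inj_on_imp_bij_betw]) (auto simp: p_def)
  moreover have "bij_betw p (U - J) (U - f ` J)"
    by (rule bij_betw_cong[THEN iffD1, OF _ h]) (auto simp: p_def)
  ultimately have "bij_betw p (J \<union> (U - J)) (f ` J \<union> (U - f ` J))"
    by (rule bij_betw_combine) auto
  moreover have "J \<union> (U - J) = U" "f ` J \<union> (U - f ` J) = U" using assms by auto
  ultimately have "bij_betw p U U" by simp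
  then have "p permutes U" using assms(3) by (intro bij_imp_permutes) (auto simp: p_def)
  then show ?thesis by (intro exI[of _ p]) (simp add: p_def)
qed

text \<open>Here each colour i is a partial injection, which extends to a permutation p i.  Indexing rows and columns
  of the matrices A i additionally by permutations, with p i acting by composition, splits the system into
  one component for each permutation g, and the edges of the path use pairwise different free blocks alpha of
  the matrices A i within one component.  There the blocks can be chosen such that the component becomes
  the identification of j n + x with k s + z; a generic choice of alpha works for all components.\<close>

lemma cert_stair_base:
  assumes s: "s > 0" and sn: "s \<le> n" and N: "N \<ge> 1" and cop: "coprime s n"
    and small: "n \<le> N * s \<or> (s = 1 \<and> n \<le> N + 1)" and ab: "\<bar>a\<bar> = 1" "\<bar>b\<bar> = 1"
  shows "cert N s n (stair N s n a b c)"
proof -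
  define E where "E j k \<longleftrightarrow> j < s \<and> k < n \<and> edge s n j k" for j k
  define col where "col = colour N a b c"
  define H where "H = {h. h permutes {..<n}}"
  have finH: "finite H" by (simp add: H_def finite_permutations)
  have idH: "id \<in> H" by (simp add: H_def permutes_id)
  have compH: "g \<circ> h \<in> H" if "g \<in> H" "h \<in> H" for g h using that by (simp add: H_def permutes_compose)
  have invH: "inv_into UNIV h \<in> H" if "h \<in> H" for h using that by (simp add: H_def permutes_inv)
  have n: "n > 0" using s sn by simp
  \<comment> \<open>A column interval of length at most \<open>N * s\<close> meets at most N + 1 row
    intervals; in the other case there are only \<open>n \<le> N + 1\<close> rows.\<close>
  have near: "k \<le> k' + N" if "E j k" "E j k'" for j k k'
  proof (cases "n \<le> N * s")
    case True
    have "k * s < (j + 1) * n" "j * n < (k' + 1) * s" using that by (auto simp: E_def edge_def)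
    then have "k * s < (k' + 1 + N) * s" using True by (simp add: algebra_simps)
    then have "k < k' + 1 + N" by (metis mult_less_cancel2)
    then show ?thesis by simp
  next
    case False
    then show ?thesis using small that by (auto simp: E_def)
  qed
  have row: "k = k'" if "E j k" "E j k'" "col j k = col j k'" for j k k'
    using colour_inj_right[OF ab(1)] near that unfolding col_def by blast
  have column: "j = j'" if "E j k" "E j' k" "col j k = col j' k" for j j' k
  proof (rule colour_inj_left[OF ab(2)])
    show "colour N a b c j k = colour N a b c j' k" using that by (simp add: col_def)
    show "j \<le> j' + N" "j' \<le> j + N"
      using edge_cases[of s n j k] edge_cases[of s n j' k] that N sn s by (auto simp: E_def)
  qed
  have "\<exists>p. p \<in> H \<and> (\<forall>j k. E j k \<longrightarrow> col j k = i \<longrightarrow> p j = k)" for i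
  proof -
    define J where "J = {j. \<exists>k. E j k \<and> col j k = i}"
    define f where "f j = (THE k. E j k \<and> col j k = i)" for j
    have f: "f j = k" if "E j k" "col j k = i" for j k
      unfolding f_def using that row by (intro the_equality) auto
    have "inj_on f J"
    proof (rule inj_onI)
      fix j j' assume "j \<in> J" "j' \<in> J" "f j = f j'"
      then obtain k k' where "E j k" "col j k = i" "E j' k'" "col j' k' = i" by (auto simp: J_def)
      with \<open>f j = f j'\<close> f column show "j = j'" by metis
    qed
    moreover have "J \<subseteq> {..<n}" "f ` J \<subseteq> {..<n}" using sn f by (auto simp: J_def E_def)
    ultimately obtain p where "p permutes {..<n}" "\<forall>j\<in>J. p j = f j"
      using partial_injection_extends[of "{..<n}" f J] by auto
    then show ?thesis using f by (auto simp: H_def J_def)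
  qed
  then obtain p where pH: "\<And>i. p i \<in> H" and p: "\<And>j k. E j k \<Longrightarrow> p (col j k) j = k" by metis
  \<comment> \<open>The path is a tree, so the permutations on its edges can be multiplied up along
    it from column 0: \<open>\<gamma> j\<close> is the product up to column j, and
    \<open>\<tau> k\<close> the product up to row k.\<close>
  define \<gamma> where "\<gamma> = rec_nat id (\<lambda>j g. g \<circ> inv_into UNIV (p (col j (Suc j * n div s))) \<circ> p (col (Suc j) (Suc j * n div s)))"
  have \<gamma>0: "\<gamma> 0 = id" and \<gamma>S: "\<gamma> (Suc j) = \<gamma> j \<circ> inv_into UNIV (p (col j (Suc j * n div s))) \<circ> p (col (Suc j) (Suc j * n div s))" for j
    by (simp_all add: \<gamma>_def)
  define \<tau> where "\<tau> k = \<gamma> (k * s div n) \<circ> inv_into UNIV (p (col (k * s div n) k))" for k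
  have \<gamma>H: "\<gamma> j \<in> H" for j
    by (induction j) (simp_all only: \<gamma>0 \<gamma>S idH compH invH pH)
  have \<tau>H: "\<tau> k \<in> H" for k by (simp only: \<tau>_def compH invH pH \<gamma>H)
  have \<gamma>\<tau>: "\<tau> k \<circ> p (col j k) = \<gamma> j" if "E j k" for j k
  proof -
    have "inv_into UNIV (p i) \<circ> p i = id" for i using pH[of i] by (auto simp: H_def permutes_inv_o)
    then have *: "g \<circ> inv_into UNIV (p i) \<circ> p i = g" for g i by (simp add: comp_assoc)
    from edge_cases[of s n j k] that sn s consider "j = k * s div n" | "j = Suc (k * s div n)" "k = j * n div s"
      by (auto simp: E_def)
    then show ?thesis
    proof cases
      case 1
      then show ?thesis by (simp add: \<tau>_def *)
    next
      case 2
      then show ?thesis using \<gamma>S[of "k * s div n"] by (simp add: \<tau>_def)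
    qed
  qed
  \<comment> \<open>The \<open>p i\<close> move vertex numbers along the edges, so walking back
    along the path sends j to 0. Hence the \<open>\<gamma> j\<close> are pairwise different, which
    keeps the blocks of different edges apart.\<close>
  have \<gamma>fix: "\<gamma> j j = 0" if "j < s" for j
    using that
  proof (induction j)
    case (Suc j)
    define K where "K = Suc j * n div s"
    have E: "E j K" "E (Suc j) K"
      using edge_corner[OF cop Suc.prems] corner_strict(3)[OF cop _ Suc.prems] Suc.prems by (auto simp: E_def K_def)
    have "inv_into UNIV (p (col j K)) K = j"
      using p[OF E(1)] pH[of "col j K"] by (metis H_def mem_Collect_eq permutes_inverses(2))
    then have "\<gamma> (Suc j) (Suc j) = \<gamma> j j" using p[OF E(2)] by (simp add: \<gamma>S K_def)
    then show ?case using Suc by simp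
  qed (simp add: \<gamma>0)
  have \<gamma>inj: "j = j'" if "j < s" "j' < s" "\<gamma> j = \<gamma> j'" for j j'
  proof -
    have "inj (\<gamma> j)" using \<gamma>H[of j] by (auto simp: H_def permutes_inj)
    then show ?thesis using \<gamma>fix[OF that(1)] \<gamma>fix[OF that(2)] that(3) by (metis injD)
  qed
  \<comment> \<open>The component of g: column j sits on the sheet
    \<open>g \<circ> \<gamma> j\<close>, and its entries are free parameters.\<close>
  define M :: "(nat \<Rightarrow> nat) \<Rightarrow> (nat \<times> (nat \<Rightarrow> nat) \<times> nat \<times> nat \<Rightarrow> complex) \<Rightarrow> nat \<times> nat \<Rightarrow> nat \<times> nat \<Rightarrow> complex"
    where "M g \<alpha> = (\<lambda>(k,z) (j,x). if edge s n j k then \<alpha> (col j k, g \<circ> \<gamma> j, z, x) else 0)" for g \<alpha>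
  have "\<exists>\<alpha>. \<forall>g\<in>H. trivial_kernel ({..<s} \<times> {..<n}) ({..<n} \<times> {..<s}) (M g \<alpha>)"
  proof (rule common_trivial_kernel[OF finH])
    fix g :: "nat \<Rightarrow> nat" and \<alpha> \<beta> :: "nat \<times> (nat \<Rightarrow> nat) \<times> nat \<times> nat \<Rightarrow> complex" and r c :: "nat \<times> nat"
    obtain k z j x where rc: "r = (k,z)" "c = (j,x)" by fastforce
    let ?i = "(col j k, g \<circ> \<gamma> j, z, x)"
    show "\<exists>p. \<forall>t. M g (\<lambda>i. \<alpha> i + t * (\<beta> i - \<alpha> i)) r c = poly p t"
      by (rule exI[of _ "if edge s n j k then [:\<alpha> ?i, \<beta> ?i - \<alpha> ?i:] else 0"]) (simp add: M_def rc)
  next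
    fix g :: "nat \<Rightarrow> nat" assume g: "g \<in> H"
    \<comment> \<open>Columns and rows are both numbered by 0, ..., s n - 1, through
      \<open>j * n + x\<close> and \<open>k * s + z\<close>, and equal numbers force overlapping
      intervals. As distinct edges use distinct blocks, this identification can be
      prescribed.\<close>
    define \<alpha> where "\<alpha> = (\<lambda>(i,h,z,x). if \<exists>j k. E j k \<and> col j k = i \<and> h = g \<circ> \<gamma> j \<and> j * n + x = k * s + z then 1 else 0 :: complex)"
    have M: "M g \<alpha> (k,z) (j,x) = (if j * n + x = k * s + z then 1 else 0)"
      if "k < n" "z < s" "j < s" "x < n" for k z j x
    proof (cases "j * n + x = k * s + z")
      case True
      then have e: "edge s n j k" using that by (simp add: edge_def algebra_simps)
      then have "E j k" using that by (simp add: E_def)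
      then show ?thesis using True e by (auto simp: M_def \<alpha>_def)
    next
      case False
      have "\<alpha> (col j k, g \<circ> \<gamma> j, z, x) = 0" if e: "edge s n j k"
      proof -
        have E: "E j k" using e \<open>k < n\<close> \<open>j < s\<close> by (simp add: E_def)
        have "\<not> (E j' k' \<and> col j' k' = col j k \<and> g \<circ> \<gamma> j = g \<circ> \<gamma> j' \<and> j' * n + x = k' * s + z)" for j' k'
        proof
          assume *: "E j' k' \<and> col j' k' = col j k \<and> g \<circ> \<gamma> j = g \<circ> \<gamma> j' \<and> j' * n + x = k' * s + z"
          have "inj g" using g by (auto simp: H_def permutes_inj)
          then have "\<gamma> j = \<gamma> j'" using * by (metis fun.inj_map_strong inj_compose inj_on_def fun.inj_map injD)
          then have "j = j'" using \<gamma>inj * E by (auto simp: E_def)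
          then show False using row[of j k k'] E * False by auto
        qed
        then show ?thesis by (auto simp: \<alpha>_def)
      qed
      then show ?thesis using False by (auto simp: M_def)
    qed
    have tk: "trivial_kernel ({..<s} \<times> {..<n}) ({..<n} \<times> {..<s}) (M g \<alpha>)"
    proof (rule trivial_kernelI)
      fix v :: "nat \<times> nat \<Rightarrow> complex" and q
      assume v: "\<And>r. r \<in> {..<n} \<times> {..<s} \<Longrightarrow> (\<Sum>c\<in>{..<s} \<times> {..<n}. M g \<alpha> r c * v c) = 0"
        and q: "q \<in> {..<s} \<times> {..<n}"
      obtain j x where jx: "q = (j,x)" "j < s" "x < n" using q by auto
      define k where "k = (j * n + x) div s"
      define z where "z = (j * n + x) mod s"
      have kz: "k * s + z = j * n + x" by (simp add: k_def z_def)
      have "j * n + x < (j + 1) * n" using jx by simp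
      also have "\<dots> \<le> s * n" using jx(2) by (intro mult_right_mono) auto
      finally have "k < n" unfolding k_def by (simp add: div_less_iff_less_mult s mult.commute)
      moreover have "z < s" by (simp add: z_def s)
      ultimately have r: "(k,z) \<in> {..<n} \<times> {..<s}" by simp
      have "M g \<alpha> (k,z) c * v c = (if c = q then v c else 0)" if c: "c \<in> {..<s} \<times> {..<n}" for c
      proof -
        obtain j' x' where c': "c = (j',x')" "j' < s" "x' < n" using c by auto
        have "j' * n + x' = j * n + x \<longleftrightarrow> c = q"
        proof
          assume *: "j' * n + x' = j * n + x"
          have "j' = (j' * n + x') div n" "j = (j * n + x) div n" using c' jx by auto
          then show "c = q" using * c' jx by simp
        qed (simp add: c' jx)
        then show ?thesis using M[of k z j' x'] r c' kz by auto
      qed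
      then have "(\<Sum>c\<in>{..<s} \<times> {..<n}. M g \<alpha> (k,z) c * v c) = v q" using q by (simp cong: sum.cong)
      then show "v q = 0" using v[OF r] by simp
    qed
    show "\<exists>\<alpha>. trivial_kernel ({..<s} \<times> {..<n}) ({..<n} \<times> {..<s}) (M g \<alpha>)"
      by (rule exI[of _ \<alpha>]) (rule tk)
  qed (auto simp: mult.commute)
  then obtain \<alpha> where \<alpha>: "\<And>g. g \<in> H \<Longrightarrow> trivial_kernel ({..<s} \<times> {..<n}) ({..<n} \<times> {..<s}) (M g \<alpha>)" by blast
  \<comment> \<open>Colour i joins the sheet t of a row to the sheet \<open>t \<circ> p i\<close> of
    a column.\<close>
  define A where "A i = (\<lambda>(t,z) (h,x). if h = t \<circ> p i then \<alpha> (i,h,z,x) else 0)" for i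
  have "trivial_kernel ({..<s} \<times> (H \<times> {..<n})) ({..<n} \<times> (H \<times> {..<s}))
     (\<lambda>(k,z) (j,x). \<Sum>i\<le>N. stair N s n a b c i k j * A i z x)"
  proof (rule trivial_kernelI)
    fix v :: "nat \<times> (nat \<Rightarrow> nat) \<times> nat \<Rightarrow> complex" and q
    assume v: "\<And>r. r \<in> {..<n} \<times> (H \<times> {..<s}) \<Longrightarrow> (\<Sum>y\<in>{..<s} \<times> (H \<times> {..<n}).
        (\<lambda>(k,z) (j,x). \<Sum>i\<le>N. stair N s n a b c i k j * A i z x) r y * v y) = 0"
      and q: "q \<in> {..<s} \<times> (H \<times> {..<n})"
    obtain j0 h0 x0 where q': "q = (j0,h0,x0)" "j0 < s" "h0 \<in> H" "x0 < n" using q by auto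
    define g where "g = h0 \<circ> inv_into UNIV (\<gamma> j0)"
    have g: "g \<in> H" using q'(3) by (simp add: g_def compH invH \<gamma>H)
    have gh: "g \<circ> \<gamma> j0 = h0"
      using \<gamma>H[of j0] by (simp add: g_def comp_assoc H_def permutes_inv_o)
    define u where "u = (\<lambda>(j,x). v (j, g \<circ> \<gamma> j, x))"
    have "u (j0,x0) = 0"
    proof (rule trivial_kernelD[OF \<alpha>[OF g]])
      fix r assume "r \<in> {..<n} \<times> {..<s}"
      then obtain k z where r: "r = (k,z)" "k < n" "z < s" by auto
      have "0 = (\<Sum>y\<in>{..<s} \<times> (H \<times> {..<n}).
          (\<Sum>i\<le>N. stair N s n a b c i k (fst y) * A i (g \<circ> \<tau> k, z) (snd y)) * v y)"
        using v[of "(k, g \<circ> \<tau> k, z)"] r g by (simp add: compH \<tau>H case_prod_unfold)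
      also have "\<dots> = (\<Sum>j<s. \<Sum>h\<in>H. \<Sum>x<n.
          (\<Sum>i\<le>N. stair N s n a b c i k j * A i (g \<circ> \<tau> k, z) (h,x)) * v (j,h,x))"
        by (simp add: sum.cartesian_product case_prod_unfold)
      also have "\<dots> = (\<Sum>j<s. \<Sum>h\<in>H. if h = g \<circ> \<gamma> j then
          \<Sum>x<n. M g \<alpha> (k,z) (j,x) * v (j,h,x) else 0)"
      proof (intro sum.cong refl)
        fix j h assume j: "j \<in> {..<s}"
        show "(\<Sum>x<n. (\<Sum>i\<le>N. stair N s n a b c i k j * A i (g \<circ> \<tau> k, z) (h,x)) * v (j,h,x))
          = (if h = g \<circ> \<gamma> j then \<Sum>x<n. M g \<alpha> (k,z) (j,x) * v (j,h,x) else 0)"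
        proof (cases "edge s n j k")
          case True
          then have "\<tau> k \<circ> p (col j k) = \<gamma> j" using j r by (intro \<gamma>\<tau>) (simp add: E_def)
          then have "g \<circ> \<tau> k \<circ> p (col j k) = g \<circ> \<gamma> j" by (simp add: comp_assoc)
          then show ?thesis using True by (simp add: sum_stair A_def M_def flip: col_def)
        qed (simp add: sum_stair M_def)
      qed
      also have "\<dots> = (\<Sum>j<s. \<Sum>x<n. M g \<alpha> (k,z) (j,x) * u (j,x))"
        using finH g \<gamma>H compH by (simp add: u_def)
      also have "\<dots> = (\<Sum>c\<in>{..<s} \<times> {..<n}. M g \<alpha> r c * u c)"
        by (simp add: sum.cartesian_product r)
      finally show "(\<Sum>c\<in>{..<s} \<times> {..<n}. M g \<alpha> r c * u c) = 0" by simp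
    next
      show "(j0,x0) \<in> {..<s} \<times> {..<n}" using q' by simp
    qed
    then show "v q = 0" using q' gh by (simp add: u_def)
  qed
  moreover have "card (H \<times> {..<n}) * s = card (H \<times> {..<s}) * n" by (simp add: card_cartesian_product)
  ultimately show ?thesis using finH idH s by (intro certI[of "H \<times> {..<s}" "H \<times> {..<n}"]) auto
qed

text \<open>The relations of a staircase module form a staircase module again, with the colours a k + b j + c
  replaced by b j - a m + (c - a), up to the signs of the basis vectors.\<close>

lemma stair_kernel:
  fixes w :: "nat \<Rightarrow> nat \<Rightarrow> complex"
  assumes cop: "coprime s n" and N: "N \<ge> 1" and n: "N * s < n" and s': "s' + n = (N + 1) * s" "s' > 0"
    and a: "\<bar>a\<bar> = 1"
    and w: "\<And>k. k < n \<Longrightarrow> (\<Sum>i\<le>N. \<Sum>j<s. stair N s n a b c i k j * w j i) = 0"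
  shows "\<exists>y. \<forall>j<s. \<forall>i\<le>N. w j i = (\<Sum>m<s'. ((-1) ^ j * stair N s' s b (-a) (c - a) i j m) * y m)"
proof -
  have s: "s > 0" "s \<le> n" "s' < s"
  proof -
    show "s' < s" using s' n by simp
    then show "s > 0" by simp
    have "1 * s \<le> N * s" using N by (rule mult_right_mono) simp
    then show "s \<le> n" using n by linarith
  qed
  define col where "col = colour N a b c"
  define col' where "col' = colour N b (-a) (c - a)"
  define K where "K j = j * n div s" for j
  have K: "K j * s \<le> j * n" "j * n < (K j + 1) * s" for j
    using dividend_less_div_times[OF s(1), of "j * n"] by (simp_all add: K_def algebra_simps)
  have wk: "(\<Sum>j<s. if edge s n j k then w j (col j k) else 0) = 0" if "k < n" for k
    using w[OF that] unfolding col_def by (subst (asm) sum.swap) (simp add: sum_stair)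
  \<comment> \<open>A row interval inside one column interval gives a single edge, so the relation
    of that row kills the entry. The remaining rows are corners with two edges.\<close>
  have interior: "w j (col j k) = 0" if j: "j < s" and k: "j * n \<le> k * s" "(k + 1) * s \<le> (j + 1) * n" for j k
  proof -
    have "(k + 1) * s \<le> s * n" using k(2) mult_right_mono[of "j + 1" s n] j by simp
    then have "k < n" using s(1) by (metis Suc_eq_plus1 Suc_le_lessD mult.commute mult_le_cancel2)
    have "edge s n j' k \<longleftrightarrow> j' = j" for j'
    proof
      assume "edge s n j' k"
      then have "j * n < (j' + 1) * n" "j' * n < (j + 1) * n" using k by (auto simp: edge_def)
      then have "j < j' + 1" "j' < j + 1" by (metis mult_less_cancel2)+
      then show "j' = j" by simp
    next
      assume "j' = j"
      have "k * s < (k + 1) * s" using s(1) by simp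
      then have "k * s < (j + 1) * n" "j * n < (k + 1) * s" using k by linarith+
      then show "edge s n j' k" using \<open>j' = j\<close> by (simp add: edge_def)
    qed
    then have "(\<Sum>j'<s. if edge s n j' k then w j' (col j' k) else 0) = w j (col j k)" using j by simp
    then show ?thesis using wk[OF \<open>k < n\<close>] by simp
  qed
  have corner: "w j (col j (K (Suc j))) + w (Suc j) (col (Suc j) (K (Suc j))) = 0" if j: "Suc j < s" for j
  proof -
    define k where "k = K (Suc j)"
    have e: "edge s n j k" "edge s n (Suc j) k" using edge_corner[OF cop j] by (auto simp: k_def K_def)
    have k: "k < n" using corner_strict(3)[OF cop _ j] by (simp add: k_def K_def)
    have "edge s n j' k \<longleftrightarrow> j' \<in> {j, Suc j}" for j'
      using e edge_cases[OF e(1) s(2,1)] edge_cases[OF e(2) s(2,1)] edge_cases[OF _ s(2,1), of j' k] by auto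
    then have "(\<Sum>j'<s. if edge s n j' k then w j' (col j' k) else 0)
      = (\<Sum>j'<s. if j' \<in> {j, Suc j} then w j' (col j' k) else 0)" by simp
    also have "\<dots> = (\<Sum>j'\<in>{j, Suc j}. w j' (col j' k))"
      using j by (subst sum.inter_restrict[symmetric]) (auto intro!: sum.cong)
    finally show ?thesis using wk[OF k] by (simp add: k_def)
  qed
  \<comment> \<open>\<open>m\<close> is the new column over the boundary \<open>j * s'\<close>. Its
    interval is closed on the right so that \<open>j = s\<close> belongs to
    \<open>m = s' - 1\<close>.\<close>
  define L where "L m j \<longleftrightarrow> m * s < j * s' \<and> j * s' \<le> (m + 1) * s" for m j
  have Lex: "\<exists>m<s'. L m j" if "0 < j" "j \<le> s" for j
  proof -
    define m where "m = (j * s' - 1) div s"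
    have p: "j * s' > 0" using that s'(2) by simp
    have "m * s \<le> j * s' - 1" "j * s' - 1 < (m + 1) * s"
      using dividend_less_div_times[OF s(1), of "j * s' - 1"] by (simp_all add: m_def algebra_simps)
    then have "L m j" using p unfolding L_def by linarith
    have "j * s' \<le> s' * s" using mult_right_mono[OF that(2), of s'] by (simp add: mult.commute)
    then have "m * s < s' * s" using \<open>L m j\<close> unfolding L_def by linarith
    with \<open>L m j\<close> show ?thesis by (metis mult_less_cancel2)
  qed
  \<comment> \<open>The boundaries of both paths add up to a multiple of s,
    \<open>j * n + j * s' = (N + 1) * j * s\<close>, where \<open>K j\<close> is a floor and
    \<open>m + 1\<close> a ceiling. Modulo N + 1 this turns \<open>a * K j\<close> into
    \<open>-a * m - a\<close>, the origin of the new colours.\<close>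
  have KL: "K j + (m + 1) = (N + 1) * j" if "L m j" for m j
  proof -
    have eq: "j * n + j * s' = ((N + 1) * j) * s"
      using s'(1) by (metis add.commute add_mult_distrib2 mult.assoc mult.commute)
    have "j * s' \<le> j * s" using s(3) by simp
    then have "m * s < j * s" using that unfolding L_def by linarith
    then have mj: "m + 1 \<le> (N + 1) * j" by (simp add: mult_less_cancel2)
    define t where "t = (N + 1) * j - (m + 1)"
    have t: "t + (m + 1) = (N + 1) * j" using mj by (simp add: t_def)
    then have "t * s + (m + 1) * s = j * n + j * s'" using eq by (metis add_mult_distrib)
    then have "s * t \<le> j * n" "j * n < s * Suc t" using that unfolding L_def
      by (simp_all add: algebra_simps)
    then have "K j = t" unfolding K_def by (rule div_nat_eqI)
    then show ?thesis using t by simp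
  qed
  have colL: "col' m j = col j (K j)" if "L m j" for m j
  proof -
    have Kj: "int (K j) = (int N + 1) * int j - int m - 1"
      using arg_cong[OF KL[OF that], of int]
      by (simp add: algebra_simps)
    then have "b * int j + - a * int m + (c - a) - (a * int (K j) + b * int j + c) = (int N + 1) * (- a * int j)"
      unfolding Kj by (simp add: algebra_simps)
    then show ?thesis unfolding col'_def col_def colour_eq_iff by simp
  qed
  have colR: "col' m j = col j (K (Suc j))" if "L m (Suc j)" for m j
  proof -
    have Kj: "int (K (Suc j)) = (int N + 1) * int (Suc j) - int m - 1"
      using arg_cong[OF KL[OF that], of int]
      by (simp add: algebra_simps)
    then have "b * int j + - a * int m + (c - a) - (a * int (K (Suc j)) + b * int j + c) = (int N + 1) * (- a * int (Suc j))"
      unfolding Kj by (simp add: algebra_simps)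
    then show ?thesis unfolding col'_def col_def colour_eq_iff by simp
  qed
  \<comment> \<open>A corner relation says that two entries add to 0; the alternating sign turns it
    into an equality along the path.\<close>
  define z where "z j = (-1) ^ j * w j (col j (K j))" for j
  have zS: "z (Suc j) = (-1) ^ j * w j (col j (K (Suc j)))" if "Suc j < s" for j
  proof -
    have "w (Suc j) (col (Suc j) (K (Suc j))) = - w j (col j (K (Suc j)))"
      using corner[OF that] by (simp add: eq_neg_iff_add_eq_0 add.commute)
    then show ?thesis by (simp add: z_def)
  qed
  \<comment> \<open>If the boundaries i and i + 1 lie over the same m, then
    \<open>K (Suc i) = K i + N + 1\<close>, so both corners of column i have the same colour and
    hence the same entry of \<open>w\<close>.\<close>
  have zconst: "z j' = z j" if "L m j" "L m j'" "j \<le> j'" "j' < s" for m j j'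
    using that(3,2,4)
  proof (induction j' rule: dec_induct)
    case (step i)
    have "m * s < i * s'" using that(1) step.hyps(1) mult_right_mono[OF step.hyps(1), of s'] unfolding L_def by linarith
    moreover have "i * s' \<le> (m + 1) * s" using step.prems(1) unfolding L_def by simp
    ultimately have Li: "L m i" by (simp add: L_def)
    then have "z (Suc i) = z i" using zS[OF step.prems(2)] colL[OF Li] colR[OF step.prems(1)] by (simp add: z_def)
    then show ?case using step.IH Li step.prems by simp
  qed simp
  define y where "y m = z (SOME j. j < s \<and> L m j)" for m
  have zy: "z j = y m" if "L m j" "j < s" for m j
  proof -
    define i where "i = (SOME j. j < s \<and> L m j)"
    have "i < s \<and> L m i" unfolding i_def by (rule someI[of _ j]) (use that in blast)
    then show ?thesis unfolding y_def i_def[symmetric]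
      using zconst[of m i j] zconst[of m j i] that by (cases "i \<le> j") auto
  qed
  have wE: "w j (col' m j) = (-1) ^ j * y m" if e: "edge s' s m j" "m < s'" "j < s" for m j
  proof (cases "m * s < j * s'")
    case True
    then have L: "L m j" using e by (simp add: L_def edge_def)
    then have "(-1) ^ j * y m = (-1) ^ j * ((-1) ^ j * w j (col j (K j)))" using zy[OF L e(3)] by (simp add: z_def)
    then show ?thesis using colL[OF L] by simp
  next
    case False
    then have L: "L m (Suc j)" using e s(3) by (simp add: L_def edge_def)
    \<comment> \<open>Because \<open>s' < s\<close>, the last row interval begins strictly inside
      the last column, which belongs to the first case.\<close>
    have "Suc j < s"
    proof (rule ccontr)
      assume "\<not> Suc j < s"
      then have sj: "s = Suc j" using e by simp
      obtain t where t: "s' = Suc t" using s'(2) by (cases s') auto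
      have "m * s \<le> t * s" using e(2) t by (intro mult_right_mono) auto
      then have "j * Suc t \<le> t * Suc j" using False unfolding sj t by linarith
      then show False using s(3) sj t by simp
    qed
    then have "(-1) ^ j * y m = (-1) ^ j * ((-1) ^ j * w j (col j (K (Suc j))))"
      using zy[OF L] zS by simp
    then show ?thesis using colR[OF L] by simp
  qed
  have edgeL: "edge s' s m j" if "L m j" "0 < j" "j < s" for m j
  proof -
    have "coprime s s'"
    proof (rule coprimeI)
      fix d assume d: "d dvd s" "d dvd s'"
      have "n = (N + 1) * s - s'" using s'(1) by simp
      then have "d dvd n" using d by (metis dvd_diff_nat dvd_mult)
      then show "is_unit d" using cop d(1) by (meson coprime_common_divisor)
    qed
    then have "\<not> s dvd j * s'"
      using that by (metis coprime_dvd_mult_left_iff nat_dvd_not_less)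
    then have "j * s' \<noteq> (m + 1) * s" by (metis dvd_triv_right)
    moreover have "j * s' < (j + 1) * s'" using s'(2) by simp
    ultimately show ?thesis using that unfolding L_def edge_def by linarith
  qed
  have edgeR: "edge s' s m j" if "L m (Suc j)" for m j
    using that s'(2) by (simp add: L_def edge_def)
  have w0: "\<exists>m<s'. edge s' s m j \<and> i = col' m j" if nz: "w j i \<noteq> 0" and j: "j < s" and i: "i \<le> N" for j i
  proof -
    \<comment> \<open>\<open>k\<close> will be the one row among \<open>K j\<close>, ...,
      \<open>K j + N\<close> in which column j has colour i; \<open>a\<close> is its own inverse. As
      \<open>N * s < n\<close>, all these rows meet column j, so \<open>k\<close> is interior or one
      of its two corners.\<close>
    define q where "q = a * (int i - b * int j - c) - int (K j)"
    define d where "d = q mod (int N + 1)"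
    define k where "k = K j + nat d"
    have d: "0 \<le> d" "d \<le> int N" using pos_mod_bound[of "int N + 1" q] by (auto simp: d_def)
    define e where "e = q div (int N + 1)"
    have kk: "int k = int (K j) + q - (int N + 1) * e"
      using d(1) by (simp add: k_def d_def e_def minus_mult_div_eq_mod)
    have "a * int k + b * int j + c - int i = (a * a - 1) * (int i - b * int j - c) - (int N + 1) * (a * e)"
      unfolding kk q_def by (simp add: algebra_simps)
    moreover have "a * a = 1" using a by (metis abs_mult_self_eq mult_1)
    ultimately have "(int N + 1) dvd (a * int k + b * int j + c) - int i" by simp
    then have "(a * int k + b * int j + c) mod (int N + 1) = int i mod (int N + 1)" by (simp add: mod_eq_dvd_iff)
    then have ik: "i = col j k" using i by (simp add: col_def colour_def)
    show ?thesis
    proof (cases "k = K j")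
      case True
      have "j > 0"
      proof (rule ccontr)
        assume "\<not> j > 0"
        then have "w j (col j k) = 0" using True s by (intro interior j) (auto simp: K_def)
        then show False using nz ik by simp
      qed
      then obtain m where "m < s'" "L m j" using Lex[of j] j by auto
      then show ?thesis using edgeL[of m j] colL[of m j] ik True j \<open>j > 0\<close> by auto
    next
      case False
      then have "(K j + 1) * s \<le> k * s" using s by (intro mult_right_mono) (auto simp: k_def)
      then have lo: "j * n \<le> k * s" using K(2)[of j] by linarith
      have "k * s \<le> (K j + N) * s" using d by (intro mult_right_mono) (auto simp: k_def)
      then have up: "k * s < (j + 1) * n" using K(1)[of j] n by (simp add: algebra_simps)
      have nint: "(j + 1) * n < (k + 1) * s" using interior[OF j lo] nz ik by (meson not_le)
      then have kK: "k = K (Suc j)" unfolding K_def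
        using up by (intro div_nat_eqI[symmetric]) (auto simp: algebra_simps)
      then obtain m where "m < s'" "L m (Suc j)" using Lex[of "Suc j"] j by auto
      then show ?thesis using edgeR[of m j] colR[of m j] ik kK by auto
    qed
  qed
  have unique: "m = m'" if "edge s' s m j" "edge s' s m' j" "col' m j = col' m' j" for m m' j
  proof (rule colour_inj_left[of "-a" N b "c - a" m j m'])
    have near: "m \<le> m' + N" if "edge s' s m j" "edge s' s m' j" for m m'
    proof -
      have "m * s < (m' + 2) * s" using that s(3) by (simp add: edge_def algebra_simps)
      then have "m < m' + 2" by (metis mult_less_cancel2)
      then show ?thesis using N by simp
    qed
    show "m \<le> m' + N" "m' \<le> m + N" using near that by auto
  qed (use a that in \<open>auto simp: col'_def\<close>)
  have "w j i = (\<Sum>m<s'. ((-1) ^ j * stair N s' s b (-a) (c - a) i j m) * y m)" if j: "j < s" and i: "i \<le> N" for j i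
  proof (cases "\<exists>m<s'. edge s' s m j \<and> i = col' m j")
    case True
    then obtain m0 where m0: "m0 < s'" "edge s' s m0 j" "i = col' m0 j" by blast
    have "(\<Sum>m<s'. ((-1) ^ j * stair N s' s b (-a) (c - a) i j m) * y m)
      = (\<Sum>m<s'. if m = m0 then (-1) ^ j * y m else 0)"
      using m0 unique by (intro sum.cong) (auto simp: stair_def col'_def)
    then show ?thesis using m0 wE[OF m0(2,1) j] by simp
  next
    case False
    then have "w j i = 0" using w0 j i by blast
    moreover have "(\<Sum>m<s'. ((-1) ^ j * stair N s' s b (-a) (c - a) i j m) * y m) = 0"
      using False by (intro sum.neutral) (auto simp: stair_def col'_def)
    ultimately show ?thesis by simp
  qed
  then show ?thesis by blast
qed

section \<open>The set of slopes\<close>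

lemma rho_pos: "N \<ge> 2 \<Longrightarrow> x \<ge> 0 \<Longrightarrow> rho N x > 0"
  by (simp add: rho_def add_pos_pos)

lemma rho_upper: "N \<ge> 2 \<Longrightarrow> x \<ge> 0 \<Longrightarrow> rho N x < 1 / (real N - 1)"
  unfolding rho_def by (intro divide_strict_left_mono mult_pos_pos add_pos_pos) auto

lemma rho_strict_mono:
  assumes "N \<ge> 2" "0 \<le> x" "x < y"
  shows "rho N x < rho N y"
proof -
  have "1 / (1 + y) < 1 / (1 + x)" using assms by (simp add: frac_less2)
  moreover have "real N - 1 + 1 / (1 + y) > 0" using assms by (intro add_pos_pos) auto
  ultimately show ?thesis unfolding rho_def by (intro divide_strict_left_mono mult_pos_pos) auto
qed

lemma rho_less_iff: "N \<ge> 2 \<Longrightarrow> x \<ge> 0 \<Longrightarrow> y \<ge> 0 \<Longrightarrow> rho N x < rho N y \<longleftrightarrow> x < y"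
  using rho_strict_mono[of N x y] rho_strict_mono[of N y x] by (cases x y rule: linorder_cases) auto

lemma rho_eq_iff: "N \<ge> 2 \<Longrightarrow> x \<ge> 0 \<Longrightarrow> y \<ge> 0 \<Longrightarrow> rho N x = rho N y \<longleftrightarrow> x = y"
  using rho_strict_mono[of N x y] rho_strict_mono[of N y x] by (cases x y rule: linorder_cases) auto

lemma rho_iter_nonneg: "N \<ge> 2 \<Longrightarrow> (rho N ^^ i) 0 \<ge> 0"
  by (induction i) (auto intro: less_imp_le rho_pos)

lemma rho_iter_less_Suc: "N \<ge> 2 \<Longrightarrow> (rho N ^^ i) 0 < (rho N ^^ Suc i) 0"
  by (induction i) (auto simp: rho_pos rho_less_iff rho_iter_nonneg less_imp_le)

lemma rho_iter_limit:
  assumes "N \<ge> 2"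
  shows "(\<lambda>i. (rho N ^^ i) 0) \<longlonglongrightarrow> phi N" "(rho N ^^ i) 0 \<le> phi N"
proof -
  have inc: "incseq (\<lambda>i. (rho N ^^ i) 0)"
    using rho_iter_less_Suc[OF assms] by (intro incseq_SucI less_imp_le)
  have "(rho N ^^ i) 0 \<le> 1 / (real N - 1)" for i
    using assms rho_upper[OF assms rho_iter_nonneg[OF assms]] by (cases i) (auto intro: less_imp_le)
  then obtain L where L: "(\<lambda>i. (rho N ^^ i) 0) \<longlonglongrightarrow> L" "\<forall>i. (rho N ^^ i) 0 \<le> L"
    using incseq_convergent[OF inc] by blast
  then show "(\<lambda>i. (rho N ^^ i) 0) \<longlonglongrightarrow> phi N" "(rho N ^^ i) 0 \<le> phi N"
    by (auto simp: phi_def limI)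
qed

lemma phi_pos: "N \<ge> 2 \<Longrightarrow> phi N > 0"
  using rho_iter_limit(2)[of N 1] rho_pos[of N 0] by simp

lemma rho_phi:
  assumes "N \<ge> 2"
  shows "rho N (phi N) = phi N"
proof -
  have "real N - 1 + 1 / (1 + phi N) > 0" using assms phi_pos[OF assms] by (intro add_pos_pos) auto
  then have "(\<lambda>i. rho N ((rho N ^^ i) 0)) \<longlonglongrightarrow> rho N (phi N)"
    unfolding rho_def[abs_def] using phi_pos[OF assms]
    by (intro tendsto_intros rho_iter_limit(1)[OF assms, unfolded rho_def[abs_def]]) auto
  moreover have "(\<lambda>i. rho N ((rho N ^^ i) 0)) \<longlonglongrightarrow> phi N"
    using LIMSEQ_Suc[OF rho_iter_limit(1)[OF assms]] by simp
  ultimately show ?thesis by (rule LIMSEQ_unique)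
qed

text \<open>\<open>rho N\<close> is increasing with fixed point \<open>phi N\<close>, and it shifts
  the iterates of 0; the starting value 0 itself is not met because
  \<open>rho N x > 0\<close>.\<close>

lemma rho_in_Phi_iff:
  assumes "N \<ge> 2" "x \<in> \<rat>" "x > 0"
  shows "rho N x \<in> Phi N \<longleftrightarrow> x \<in> Phi N"
proof -
  have "rho N x > phi N \<longleftrightarrow> x > phi N"
    using rho_less_iff[OF assms(1), of "phi N" x] rho_phi[OF assms(1)] phi_pos[OF assms(1)] assms(3) by simp
  moreover have "rho N x \<in> \<rat>" using assms(2) unfolding rho_def by auto
  moreover have "(\<exists>i. rho N x = (rho N ^^ i) 0) \<longleftrightarrow> (\<exists>i. x = (rho N ^^ i) 0)"
  proof
    assume "\<exists>i. rho N x = (rho N ^^ i) 0"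
    then obtain i where i: "rho N x = (rho N ^^ i) 0" by blast
    then obtain j where "i = Suc j" using rho_pos[OF assms(1), of x] assms(3) by (cases i) auto
    then have "x = (rho N ^^ j) 0"
      using i rho_eq_iff[OF assms(1), of x] rho_iter_nonneg[OF assms(1)] assms(3) by simp
    then show "\<exists>i. x = (rho N ^^ i) 0" ..
  next
    assume "\<exists>i. x = (rho N ^^ i) 0"
    then obtain i where "x = (rho N ^^ i) 0" ..
    then have "rho N x = (rho N ^^ Suc i) 0" by simp
    then show "\<exists>i. rho N x = (rho N ^^ i) 0" ..
  qed
  ultimately show ?thesis using assms(2) by (auto simp: Phi_def)
qed

lemma rho_0: "N \<ge> 2 \<Longrightarrow> rho N 0 = 1 / real N"
  by (simp add: rho_def)

text \<open>The gap of \<open>Phi N\<close> between 0 and its first positive iterate. In terms of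
  dimensions it excludes \<open>n > (N + 1) * s\<close>.\<close>

lemma Phi_ge:
  assumes "N \<ge> 2" "x \<in> Phi N" "x > 0"
  shows "x \<ge> 1 / real N"
proof -
  have *: "1 / real N \<le> (rho N ^^ Suc i) 0" for i
  proof (induction i)
    case (Suc i)
    then show ?case using rho_iter_less_Suc[OF assms(1), of "Suc i"] by linarith
  qed (simp add: rho_0 assms(1))
  have "1 / real N \<le> phi N" using rho_iter_limit(2)[OF assms(1), of 1] by (simp add: rho_0 assms(1))
  moreover have "1 / real N \<le> (rho N ^^ i) 0" if "(rho N ^^ i) 0 > 0" for i
    using that *[of "i - 1"] by (cases i) auto
  ultimately show ?thesis using assms(2,3) by (auto simp: Phi_def)
qed

text \<open>The origin of the formula for \<open>rho N\<close>: with
  \<open>x = s' / (s - s')\<close> one has \<open>1 / (1 + x) = (s - s') / s\<close>, and adding N -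
  1 gives \<open>(n - s) / s\<close>.\<close>

lemma rho_reflect:
  assumes "N \<ge> 2" "s' + n = (N + 1) * s" "s' < s" "s < n" "s' > 0"
  shows "rho N (real s' / real (s - s')) = real s / real (n - s)"
proof -
  have s: "real s > 0" "real (s - s') = real s - real s'" "real (n - s) = real n - real s" using assms by auto
  have n: "real n = (real N + 1) * real s - real s'" using arg_cong[OF assms(2), of real] by (simp add: algebra_simps)
  have "1 + real s' / real (s - s') = real s / real (s - s')" using s assms by (simp add: field_simps)
  then have "real N - 1 + 1 / (1 + real s' / real (s - s')) = real N - 1 + real (s - s') / real s" by simp
  also have "\<dots> = real (n - s) / real s" using s by (simp add: n field_simps)
  finally show ?thesis by (simp add: rho_def)
qed

lemma cert_stair:
  assumes "N \<ge> 2" "coprime s n" "0 < s" "s < n" "real s / real (n - s) \<in> Phi N" "\<bar>a\<bar> = 1" "\<bar>b\<bar> = 1"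
  shows "cert N s n (stair N s n a b c)"
  using assms(2-)
proof (induction s arbitrary: n a b c rule: less_induct)
  case (less s)
  have ge: "n \<le> (N + 1) * s"
  proof -
    have "real s / real (n - s) \<ge> 1 / real N" using Phi_ge[OF assms(1) less.prems(4)] less.prems by simp
    then have "real (n - s) \<le> real N * real s" using less.prems assms(1) by (simp add: field_simps)
    then have "n - s \<le> N * s" by (metis of_nat_le_iff of_nat_mult)
    then show ?thesis by simp
  qed
  show ?case
  \<comment> \<open>Reflection gives \<open>0 < s' < s\<close> exactly for
    \<open>N * s < n < (N + 1) * s\<close>. The upper end is the slope 1 / N, where coprimality
    leaves only \<open>s = 1\<close>.\<close>
  proof (cases "n \<le> N * s \<or> n = (N + 1) * s")
    case True
    then have "n \<le> N * s \<or> (s = 1 \<and> n \<le> N + 1)"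
    proof
      assume n: "n = (N + 1) * s"
      then have "s dvd n" by simp
      then have "s = 1" using less.prems(1) by (metis coprime_absorb_left is_unit_gcd nat_dvd_1_iff_1)
      then show ?thesis using n by simp
    qed simp
    then show ?thesis using cert_stair_base less.prems assms(1) by simp
  next
    case False
    define s' where "s' = (N + 1) * s - n"
    have s': "s' + n = (N + 1) * s" "s' > 0" "s' < s" "N * s < n" using ge False by (auto simp: s'_def)
    have cop: "coprime s' s"
    proof (rule coprimeI)
      fix d assume d: "d dvd s'" "d dvd s"
      have "n = (N + 1) * s - s'" using s'(1) by simp
      then have "d dvd n" using d by (metis dvd_diff_nat dvd_mult)
      then show "is_unit d" using less.prems(1) d(2) by (meson coprime_common_divisor)
    qed
    have "real s' / real (s - s') \<in> Phi N"
      using rho_in_Phi_iff[OF assms(1), of "real s' / real (s - s')"] rho_reflect[OF assms(1) s'(1,3) less.prems(3) s'(2)]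
        less.prems(4) s' by (simp add: Rats_divide)
    then have "cert N s' s (stair N s' s b (-a) (c - a))"
      using less.IH[OF s'(3) cop s'(2,3)] less.prems by simp
    then have "cert N s' s (\<lambda>i j m. (-1) ^ j * stair N s' s b (-a) (c - a) i j m)"
      by (rule cert_scale) simp
    then show ?thesis
    proof (rule cert_reflect[OF _ s'(1) less.prems(2)])
      show "\<exists>y. \<forall>j<s. \<forall>i\<le>N. w j i = (\<Sum>m<s'. (- 1) ^ j * stair N s' s b (- a) (c - a) i j m * y m)"
        if "\<And>k. k < n \<Longrightarrow> (\<Sum>i\<le>N. \<Sum>j<s. stair N s n a b c i k j * w j i) = 0" for w :: "nat \<Rightarrow> nat \<Rightarrow> complex"
        using assms(1) by (intro stair_kernel[OF less.prems(1) _ s'(4,1,2) less.prems(5) that]) auto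
    qed
  qed
qed

section \<open>Destabilising subspaces\<close>

lemma spanning_independent_subset:
  fixes u :: "'r \<Rightarrow> 'c \<Rightarrow> complex"
  assumes "finite C"
  shows "\<exists>J\<subseteq>C. trivial_kernel J R u \<and> (\<exists>D. \<forall>c\<in>C. \<forall>r\<in>R. u r c = (\<Sum>l\<in>J. u r l * D l c))"
proof -
  have "\<exists>J\<subseteq>C. trivial_kernel J R u \<and> (\<forall>c\<in>C. \<exists>d. \<forall>r\<in>R. u r c = (\<Sum>l\<in>J. u r l * d l))"
    using assms
  proof (induction C)
    case empty
    show ?case by (simp add: trivial_kernel_def)
  next
    case (insert c C)
    then obtain J where J: "J \<subseteq> C" "trivial_kernel J R u"
      and D: "\<And>c. c \<in> C \<Longrightarrow> \<exists>d. \<forall>r\<in>R. u r c = (\<Sum>l\<in>J. u r l * d l)" by blast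
    have fin: "finite J" "c \<notin> J" using J insert.hyps finite_subset by auto
    show ?case
    proof (cases "\<exists>d. \<forall>r\<in>R. u r c = (\<Sum>l\<in>J. u r l * d l)")
      case True
      with J D show ?thesis by blast
    next
      case False
      have "trivial_kernel (insert c J) R u"
      proof (rule trivial_kernelI)
        fix v x assume v: "\<And>r. r \<in> R \<Longrightarrow> (\<Sum>l\<in>insert c J. u r l * v l) = 0" and x: "x \<in> insert c J"
        have v': "u r c * v c + (\<Sum>l\<in>J. u r l * v l) = 0" if "r \<in> R" for r
          using v[OF that] fin by simp
        have vc: "v c = 0"
        proof (rule ccontr)
          assume nz: "v c \<noteq> 0"
          have "u r c = (\<Sum>l\<in>J. u r l * (- v l / v c))" if "r \<in> R" for r
          proof -
            have "u r c = - (\<Sum>l\<in>J. u r l * v l) / v c"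
              using v'[OF that] nz by (simp add: field_simps eq_neg_iff_add_eq_0)
            then show ?thesis by (simp add: sum_divide_distrib sum_negf)
          qed
          then have "\<exists>d. \<forall>r\<in>R. u r c = (\<Sum>l\<in>J. u r l * d l)"
            by (intro exI[of _ "\<lambda>l. - v l / v c"] ballI)
          with False show False by (rule notE)
        qed
        have "v l = 0" if "l \<in> J" for l
          by (rule trivial_kernelD[OF J(2) _ that]) (use v' vc in auto)
        then show "v x = 0" using vc x by auto
      qed
      moreover have "\<exists>d. \<forall>r\<in>R. u r c' = (\<Sum>l\<in>insert c J. u r l * d l)" if c': "c' \<in> insert c C" for c'
      proof (cases "c' = c")
        case True
        have "(\<Sum>l\<in>J. u r l * (if l = c then 1 else 0)) = 0" for r using fin by (intro sum.neutral) auto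
        then show ?thesis using True fin by (intro exI[of _ "\<lambda>l. if l = c then 1 else 0"]) simp
      next
        case False
        then have "c' \<in> C" using c' by simp
        from D[OF this] obtain d where d: "\<forall>r\<in>R. u r c' = (\<Sum>l\<in>J. u r l * d l)" by (rule exE)
        have "(\<Sum>l\<in>J. u r l * (d(c := 0)) l) = (\<Sum>l\<in>J. u r l * d l)" for r
          using fin by (intro sum.cong) auto
        then show ?thesis using d fin by (intro exI[of _ "d(c := 0)"]) simp
      qed
      moreover have "insert c J \<subseteq> insert c C" using J by blast
      ultimately show ?thesis by blast
    qed
  qed
  then obtain J where "J \<subseteq> C" "trivial_kernel J R u"
    "\<forall>c\<in>C. \<exists>d. \<forall>r\<in>R. u r c = (\<Sum>l\<in>J. u r l * d l)" by blast
  moreover from bchoice[OF this(3)] obtain d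
    where "\<forall>c\<in>C. \<forall>r\<in>R. u r c = (\<Sum>l\<in>J. u r l * d c l)" by (rule exE)
  ultimately show ?thesis by (intro exI[of _ J] conjI exI[of _ "\<lambda>l c. d c l"])
qed

lemma independent_factorisation:
  fixes u :: "'r \<Rightarrow> 'c \<Rightarrow> complex"
  assumes "finite C"
  shows "\<exists>m Y D. m \<le> card C \<and> trivial_kernel {..<m} R (Y :: 'r \<Rightarrow> nat \<Rightarrow> complex) \<and>
    (\<forall>c\<in>C. \<forall>r\<in>R. u r c = (\<Sum>b<m. Y r b * D b c))"
proof -
  obtain J D where J: "J \<subseteq> C" "trivial_kernel J R u"
    and D: "\<And>c r. c \<in> C \<Longrightarrow> r \<in> R \<Longrightarrow> u r c = (\<Sum>l\<in>J. u r l * D l c)"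
    using spanning_independent_subset[OF assms, of R u] by blast
  have "finite J" using J assms finite_subset by blast
  then obtain g where g: "bij_betw g {..<card J} J"
    using ex_bij_betw_nat_finite by (auto simp: atLeast0LessThan)
  have "trivial_kernel {..<card J} R (\<lambda>r b. u r (g b))"
    using trivial_kernel_reindex[OF g bij_betw_id, of R u] J(2) by simp
  moreover have "\<forall>c\<in>C. \<forall>r\<in>R. u r c = (\<Sum>b<card J. u r (g b) * D (g b) c)"
  proof (intro ballI)
    fix c r assume "c \<in> C" "r \<in> R"
    then show "u r c = (\<Sum>b<card J. u r (g b) * D (g b) c)"
      using D sum.reindex_bij_betw[OF g, of "\<lambda>l. u r l * D l c"] by simp
  qed
  moreover have "card J \<le> card C" using J(1) assms by (rule card_mono[rotated])
  ultimately show ?thesis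
    by (intro exI[of _ "card J"] exI[of _ "\<lambda>r b. u r (g b)"] exI[of _ "\<lambda>b c. D (g b) c"]) simp
qed

text \<open>Rank and nullity: the columns of \<open>E\<close> are independent relations among the
  columns of \<open>u\<close>. No nonzero combination of them is supported on the independent
  columns \<open>J\<close>, so they stay independent on \<open>C - J\<close>, which bounds their
  number.\<close>

lemma factorisation_of_relations:
  fixes u :: "'r \<Rightarrow> 'c \<Rightarrow> complex"
  assumes C: "finite C" and I: "finite I" "trivial_kernel I C E"
    and rel: "\<And>a r. a \<in> I \<Longrightarrow> r \<in> R \<Longrightarrow> (\<Sum>c\<in>C. u r c * E c a) = 0"
  shows "\<exists>m Y D. m + card I \<le> card C \<and> (\<forall>c\<in>C. \<forall>r\<in>R. u r c = (\<Sum>b<m. Y r b * D b c))"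
proof -
  obtain J F where J: "J \<subseteq> C" "trivial_kernel J R u"
    and F: "\<And>c r. c \<in> C \<Longrightarrow> r \<in> R \<Longrightarrow> u r c = (\<Sum>l\<in>J. u r l * F l c)"
    using spanning_independent_subset[OF C, of R u] by blast
  have finJ: "finite J" using J C finite_subset by blast
  have "trivial_kernel I (C - J) E"
  proof (rule trivial_kernelI)
    fix x a assume x: "\<And>c. c \<in> C - J \<Longrightarrow> (\<Sum>a\<in>I. E c a * x a) = 0" and a: "a \<in> I"
    define \<rho> where "\<rho> c = (\<Sum>a\<in>I. E c a * x a)" for c
    have "\<rho> c = 0" if "c \<in> J" for c
    proof (rule trivial_kernelD[OF J(2) _ that])
      fix r assume r: "r \<in> R"
      have "(\<Sum>c\<in>J. u r c * \<rho> c) = (\<Sum>c\<in>C. u r c * \<rho> c)"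
        using x J(1) C by (intro sum.mono_neutral_left) (auto simp: \<rho>_def)
      also have "\<dots> = (\<Sum>a\<in>I. (\<Sum>c\<in>C. u r c * E c a) * x a)"
        unfolding \<rho>_def sum_distrib_left sum_distrib_right by (subst sum.swap) (simp add: mult.assoc)
      finally show "(\<Sum>c\<in>J. u r c * \<rho> c) = 0" using rel r by simp
    qed
    then have "(\<Sum>a\<in>I. E c a * x a) = 0" if "c \<in> C" for c using that x unfolding \<rho>_def by blast
    then show "x a = 0" by (rule trivial_kernelD[OF I(2) _ a])
  qed
  then have "card I \<le> card (C - J)" by (rule trivial_kernel_card_le) (use I C in auto)
  then have le: "card J + card I \<le> card C"
    using card_Diff_subset[OF finJ J(1)] card_mono[OF C J(1)] by simp
  obtain g where g: "bij_betw g {..<card J} J"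
    using ex_bij_betw_nat_finite[OF finJ] by (auto simp: atLeast0LessThan)
  have "\<forall>c\<in>C. \<forall>r\<in>R. u r c = (\<Sum>b<card J. u r (g b) * F (g b) c)"
  proof (intro ballI)
    fix c r assume "c \<in> C" "r \<in> R"
    then show "u r c = (\<Sum>b<card J. u r (g b) * F (g b) c)"
      using F sum.reindex_bij_betw[OF g, of "\<lambda>l. u r l * F l c"] by simp
  qed
  with le show ?thesis
    by (intro exI[of _ "card J"] exI[of _ "\<lambda>r b. u r (g b)"] exI[of _ "\<lambda>b c. F (g b) c"]) simp
qed

text \<open>\<open>X\<close> spans a subspace of dimension w, and the m columns of \<open>Y\<close>
  span a space containing all its images, so \<open>m * s < n * w\<close> violates semistability.
  The module \<open>f\<close> is arbitrary because passing to relations may leave the class of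
  multiplication modules.\<close>

lemma destabilising_subspace:
  fixes f :: "nat \<Rightarrow> nat \<Rightarrow> nat \<Rightarrow> complex"
  assumes "N \<ge> 2" "0 < s" "s < n" "real s / real (n - s) \<notin> Phi N"
  shows "\<exists>w m X Y C. 0 < w \<and> m * s < n * w \<and> trivial_kernel {..<w} {..<s} (X :: nat \<Rightarrow> nat \<Rightarrow> complex) \<and>
    (\<forall>i\<le>N. \<forall>a<w. \<forall>k<n. (\<Sum>j<s. f i k j * X j a) = (\<Sum>b<m. Y k b * (C i b a :: complex)))"
  using assms(2-)
proof (induction s arbitrary: n f rule: less_induct)
  case (less s)
  show ?case
  proof (cases "n > (N + 1) * s")
    case True
    \<comment> \<open>The images of a coordinate line span at most N + 1 dimensions, too few when
      \<open>n > (N + 1) * s\<close>.\<close>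
    have "trivial_kernel {..<1} {..<s} (\<lambda>j a :: nat. if j = 0 then 1 else 0)"
      using less.prems(1) by (auto simp: trivial_kernel_def)
    moreover have "(\<Sum>j<s. f i k j * (if j = 0 then 1 else 0)) = (\<Sum>b<N+1. f b k 0 * (if b = i then 1 else 0))"
      if "i \<le> N" for i k
    proof -
      have eq: "(\<Sum>j<s. f i k j * (if j = 0 then 1 else 0)) = (\<Sum>j<s. if j = 0 then f i k j else 0)"
        "(\<Sum>b<N+1. f b k 0 * (if b = i then 1 else 0)) = (\<Sum>b<N+1. if b = i then f b k 0 else 0)"
        by (rule sum.cong[OF refl]; simp)+
      show ?thesis unfolding eq using that less.prems(1) by (simp del: sum.lessThan_Suc)
    qed
    ultimately show ?thesis using True
      by (intro exI[of _ 1] exI[of _ "N+1"] exI[of _ "\<lambda>j a. if j = 0 then 1 else 0"]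
        exI[of _ "\<lambda>k b. f b k 0"] exI[of _ "\<lambda>i b a. if b = i then 1 else 0"]) simp
  next
    case False
    define s' where "s' = (N + 1) * s - n"
    have s': "s' + n = (N + 1) * s" using False by (simp add: s'_def)
    have rat: "real s / real (n - s) \<in> \<rat>" by simp
    \<comment> \<open>A slope equal to \<open>phi N\<close> needs no separate case: reflection would
      fix it while lowering s, so the induction covers it.\<close>
    then have le: "real s / real (n - s) \<le> phi N" using less.prems(3) by (auto simp: Phi_def)
    have "s' \<noteq> 0"
    proof
      assume "s' = 0"
      then have "n - s = N * s" using s' by simp
      then have "real s / real (n - s) = (rho N ^^ 1) 0"
        using less.prems(1) assms(1) by (simp add: rho_0)
      then show False using less.prems(3) unfolding Phi_def by blast
    qed
    have "real s / real (n - s) < 1 / (real N - 1)"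
      using le rho_upper[OF assms(1), of "phi N"] rho_phi[OF assms(1)] phi_pos[OF assms(1)] by simp
    then have "real s * (real N - 1) < real (n - s)"
      using less.prems assms(1) by (simp add: field_simps)
    then have "real (N * s) < real n" using less.prems(2) by (simp add: algebra_simps of_nat_diff)
    then have "N * s < n" by (simp only: of_nat_less_iff)
    then have s's: "s' < s" using s' by simp
    have notin: "real s' / real (s - s') \<notin> Phi N"
      using rho_in_Phi_iff[OF assms(1), of "real s' / real (s - s')"]
        rho_reflect[OF assms(1) s' s's less.prems(2)] less.prems(3) \<open>s' \<noteq> 0\<close> s's by simp
    have card: "card ({..N} \<times> {..<s}) - card {..<n} = s'" by (simp add: s'_def)
    \<comment> \<open>The module of relations: entry (j, m) of its i-th arrow is the coordinate (i,
      j) of the m-th relation.\<close>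
    obtain B where B: "\<And>m k. m < s' \<Longrightarrow> k < n \<Longrightarrow> (\<Sum>(i,j)\<in>{..N} \<times> {..<s}. f i k j * B m (i,j)) = 0"
      and tkB: "trivial_kernel {..<s'} ({..N} \<times> {..<s}) (\<lambda>c m. B m c)"
      using independent_solutions[of "{..<n}" "{..N} \<times> {..<s}" "\<lambda>k (i,j). f i k j"]
      unfolding card by (auto simp: case_prod_beta)
    obtain w' m' X' Y' C' where w': "0 < w'" "m' * s' < s * w'" "trivial_kernel {..<w'} {..<s'} X'"
      and XY: "\<And>i a j. i \<le> N \<Longrightarrow> a < w' \<Longrightarrow> j < s \<Longrightarrow>
        (\<Sum>m<s'. B m (i,j) * X' m a) = (\<Sum>b<m'. Y' j b * (C' i b a :: complex))"
      using less.IH[OF s's _ s's notin, of "\<lambda>i j m. B m (i,j)"] \<open>s' \<noteq> 0\<close> by auto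
    \<comment> \<open>The new subspace is the target part of the destabilising pair for the
      relations, thinned to an independent family \<open>Z\<close>.\<close>
    obtain m0 Z D where m0: "m0 \<le> m'" "trivial_kernel {..<m0} {..<s} (Z :: nat \<Rightarrow> nat \<Rightarrow> complex)"
      and ZD: "\<And>b j. b < m' \<Longrightarrow> j < s \<Longrightarrow> Y' j b = (\<Sum>l<m0. Z j l * D l b)"
      using independent_factorisation[of "{..<m'}" "{..<s}" Y'] by auto
    define E where "E = (\<lambda>(i,l) a. \<Sum>b<m'. D l b * C' i b a)"
    have XE: "(\<Sum>m<s'. B m (i,j) * X' m a) = (\<Sum>l<m0. Z j l * E (i,l) a)"
      if "i \<le> N" "a < w'" "j < s" for i a j
    proof -
      have "(\<Sum>m<s'. B m (i,j) * X' m a) = (\<Sum>b<m'. \<Sum>l<m0. Z j l * (D l b * C' i b a))"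
        unfolding XY[OF that] using ZD that(3) by (intro sum.cong) (auto simp: sum_distrib_right mult.assoc)
      also have "\<dots> = (\<Sum>l<m0. Z j l * E (i,l) a)"
        by (subst sum.swap) (simp add: E_def sum_distrib_left)
      finally show ?thesis .
    qed
    \<comment> \<open>The \<open>w'\<close> vectors of \<open>X'\<close> stay independent as
      relations among the images of \<open>Z\<close>, since \<open>B\<close> and \<open>X'\<close>
      are injective.\<close>
    have tkE: "trivial_kernel {..<w'} ({..N} \<times> {..<m0}) E"
    proof (rule trivial_kernelI)
      fix x a assume x: "\<And>c. c \<in> {..N} \<times> {..<m0} \<Longrightarrow> (\<Sum>a<w'. E c a * x a) = 0" and a: "a \<in> {..<w'}"
      have "(\<Sum>a<w'. X' m a * x a) = 0" if m: "m \<in> {..<s'}" for m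
      proof (rule trivial_kernelD[OF tkB _ m])
        fix c assume "c \<in> {..N} \<times> {..<s}"
        then obtain i j where c: "c = (i,j)" "i \<le> N" "j < s" by auto
        have "(\<Sum>m<s'. B m c * (\<Sum>a<w'. X' m a * x a)) = (\<Sum>a<w'. (\<Sum>m<s'. B m (i,j) * X' m a) * x a)"
          unfolding sum_distrib_left sum_distrib_right c by (subst sum.swap) (simp add: mult.assoc)
        also have "\<dots> = (\<Sum>a<w'. \<Sum>l<m0. Z j l * (E (i,l) a * x a))"
          by (intro sum.cong refl) (simp add: XE c sum_distrib_right mult.assoc)
        also have "\<dots> = (\<Sum>l<m0. Z j l * (\<Sum>a<w'. E (i,l) a * x a))"
          unfolding sum_distrib_left by (rule sum.swap)
        also have "\<dots> = 0" using x c by simp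
        finally show "(\<Sum>m<s'. B m c * (\<Sum>a<w'. X' m a * x a)) = 0" .
      qed
      then show "x a = 0" by (rule trivial_kernelD[OF w'(3) _ a])
    qed
    define u where "u k = (\<lambda>(i,l). \<Sum>j<s. f i k j * Z j l)" for k
    have rel: "(\<Sum>c\<in>{..N} \<times> {..<m0}. u k c * E c a) = 0" if a: "a \<in> {..<w'}" and k: "k \<in> {..<n}" for a k
    proof -
      have "(\<Sum>c\<in>{..N} \<times> {..<m0}. u k c * E c a) = (\<Sum>i\<le>N. \<Sum>l<m0. \<Sum>j<s. f i k j * (Z j l * E (i,l) a))"
        by (subst sum.cartesian_product) (auto intro!: sum.cong simp: u_def sum_distrib_right mult.assoc)
      also have "\<dots> = (\<Sum>i\<le>N. \<Sum>j<s. f i k j * (\<Sum>l<m0. Z j l * E (i,l) a))"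
        unfolding sum_distrib_left by (rule sum.cong[OF refl], rule sum.swap)
      also have "\<dots> = (\<Sum>i\<le>N. \<Sum>j<s. f i k j * (\<Sum>m<s'. B m (i,j) * X' m a))"
        using XE a by simp
      also have "\<dots> = (\<Sum>c\<in>{..N} \<times> {..<s}. \<Sum>m<s'. f (fst c) k (snd c) * B m c * X' m a)"
        by (subst sum.cartesian_product) (simp add: sum_distrib_left mult.assoc case_prod_unfold)
      also have "\<dots> = (\<Sum>m<s'. (\<Sum>c\<in>{..N} \<times> {..<s}. f (fst c) k (snd c) * B m c) * X' m a)"
        unfolding sum_distrib_right by (rule sum.swap)
      also have "\<dots> = 0"
        using B k by (intro sum.neutral) (simp add: case_prod_unfold)
      finally show ?thesis .
    qed
    obtain m Y F where m: "m + w' \<le> (N + 1) * m0"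
      and YF: "\<And>i l k. i \<le> N \<Longrightarrow> l < m0 \<Longrightarrow> k < n \<Longrightarrow> u k (i,l) = (\<Sum>b<m. Y k b * F b (i,l))"
      using factorisation_of_relations[of "{..N} \<times> {..<m0}" "{..<w'}" E "{..<n}" u, OF _ _ tkE rel] by auto
    \<comment> \<open>The \<open>(N + 1) * m0\<close> images of \<open>Z\<close> satisfy
      \<open>w'\<close> independent relations; with \<open>s' * m0 \<le> m' * s' < s * w'\<close>
      the inequality passes from the relations back to \<open>f\<close>.\<close>
    have "m * s + w' * s \<le> (N + 1) * s * m0"
      using mult_right_mono[OF m, of s] by (simp add: algebra_simps)
    also have "\<dots> = s' * m0 + n * m0" unfolding s'[symmetric] by (simp add: algebra_simps)
    also have "s' * m0 \<le> m' * s'" using m0(1) by (simp add: mult.commute)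
    finally have ineq: "m * s < n * m0" using w'(2) by (simp add: mult.commute)
    then have "m0 > 0" by (cases m0) auto
    with ineq m0(2) YF show ?thesis
      by (intro exI[of _ m0] exI[of _ m] exI[of _ Z] exI[of _ Y] exI[of _ "\<lambda>i b a. F b (i,a)"])
        (auto simp: u_def)
  qed
qed

section \<open>Modules of binary forms\<close>

interpretation cpoly: vector_space "Polynomial.smult :: complex \<Rightarrow> complex poly \<Rightarrow> complex poly"
  by unfold_locales (simp_all add: Polynomial.smult_add_right Polynomial.smult_add_left)

lemma S_subset_span: "S a \<subseteq> cspan ((\<lambda>j. monom 1 j) ` {..a})"
proof
  fix p :: "complex poly" assume "p \<in> S a"
  then have "degree p \<le> a" by (simp add: S_def)
  then have p: "p = (\<Sum>j\<le>a. Polynomial.smult (coeff p j) (monom 1 j))"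
    by (simp add: smult_monom poly_as_sum_of_monoms')
  show "p \<in> cspan ((\<lambda>j. monom 1 j) ` {..a})"
    by (subst p) (intro cpoly.span_sum cpoly.span_scale cpoly.span_base imageI)
qed

lemma finite_basis:
  assumes "V \<subseteq> S a"
  obtains B where "B \<subseteq> V" "finite B" "cpoly.independent B" "V \<subseteq> cspan B" "card B = cdim V"
proof -
  obtain B where B: "B \<subseteq> V" "cpoly.independent B" "V \<subseteq> cspan B" "card B = cdim V"
    using cpoly.basis_exists by blast
  have "B \<subseteq> cspan ((\<lambda>j. monom 1 j) ` {..a})" using B(1) assms S_subset_span by blast
  then have "finite B" using cpoly.independent_span_bound[OF _ B(2)] by blast
  with B that show ?thesis by blast
qed

lemma csubspace_S: "csubspace (S a)"
  by (auto simp: cpoly.subspace_def S_def intro: degree_add_le order_trans[OF degree_smult_le])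

lemma cdim_span_family:
  assumes "\<And>c a. (\<Sum>a<w. Polynomial.smult (c a) (p a)) = 0 \<Longrightarrow> a < w \<Longrightarrow> c a = 0"
  shows "cdim (cspan (p ` {..<w})) = w"
proof -
  have inj: "inj_on p {..<w}"
  proof (rule inj_onI, rule ccontr)
    fix a b assume ab: "a \<in> {..<w}" "b \<in> {..<w}" "p a = p b" "a \<noteq> b"
    let ?c = "\<lambda>x. if x = a then 1 else if x = b then - 1 else 0 :: complex"
    have "(\<Sum>x<w. Polynomial.smult (?c x) (p x)) = (\<Sum>x<w. if x = a then p x else 0) + (\<Sum>x<w. if x = b then - p x else 0)"
      using ab(4) by (subst sum.distrib[symmetric], intro sum.cong) auto
    also have "\<dots> = 0" using ab by simp
    finally show False using assms[of ?c a] ab(1) by simp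
  qed
  have "cpoly.independent (p ` {..<w})"
  proof (rule cpoly.independent_if_scalars_zero)
    fix f x assume f: "(\<Sum>x\<in>p ` {..<w}. Polynomial.smult (f x) x) = 0" and x: "x \<in> p ` {..<w}"
    have "(\<Sum>a<w. Polynomial.smult (f (p a)) (p a)) = 0" using f inj by (simp add: sum.reindex)
    then show "f x = 0" using assms[of "f \<circ> p"] x by auto
  qed simp
  then show ?thesis using inj by (simp add: cpoly.dim_span cpoly.dim_eq_card_independent card_image)
qed

definition mulmat :: "(nat \<Rightarrow> complex poly) \<Rightarrow> nat \<Rightarrow> nat \<Rightarrow> nat \<Rightarrow> complex" where
  "mulmat g i k j = coeff (monom 1 j * g i) k"

lemma coeff_mult_mulmat:
  assumes "degree h < s"
  shows "coeff (g i * h) k = (\<Sum>j<s. mulmat g i k j * coeff h j)"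
proof -
  have h: "h = (\<Sum>j<s. Polynomial.smult (coeff h j) (monom 1 j))"
    using poly_as_sum_of_monoms'[of h "s - 1"] assms
    by (cases s) (simp_all add: smult_monom lessThan_Suc_atMost)
  have "g i * h = (\<Sum>j<s. Polynomial.smult (coeff h j) (monom 1 j * g i))"
    by (subst h) (simp add: sum_distrib_left mult.commute)
  then show ?thesis by (simp add: coeff_sum mulmat_def mult.commute)
qed

lemma prodsp_subset:
  assumes "csubspace T" "\<And>f h. f \<in> F \<Longrightarrow> h \<in> H \<Longrightarrow> f * h \<in> T"
  shows "prodsp (cspan F) (cspan H) \<subseteq> T"
proof -
  have "f * h \<in> T" if f: "f \<in> cspan F" and h: "h \<in> cspan H" for f h
    using f
  proof (induction rule: cpoly.span_induct_alt)
    case base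
    show ?case using assms(1) by (simp add: cpoly.subspace_0)
  next
    case (step c x y)
    have "x * h \<in> T" using h
    proof (induction rule: cpoly.span_induct_alt)
      case base
      show ?case using assms(1) by (simp add: cpoly.subspace_0)
    next
      case (step c y z)
      then show ?case using assms(2)[OF \<open>x \<in> F\<close> step(1)]
        by (simp add: distrib_left cpoly.subspace_add[OF assms(1)] cpoly.subspace_scale[OF assms(1)])
    qed
    then show ?case using step
      by (simp add: distrib_right cpoly.subspace_add[OF assms(1)] cpoly.subspace_scale[OF assms(1)])
  qed
  then show ?thesis unfolding prodsp_def by (intro cpoly.span_minimal assms(1)) auto
qed

lemma semistable_of_trivial_kernel:
  fixes A :: "nat \<Rightarrow> nat \<Rightarrow> nat \<Rightarrow> complex"
  assumes g: "\<And>i. i \<le> N \<Longrightarrow> degree (g i) \<le> r" and s: "s > 0"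
    and PQ: "P > 0" "Q * s = P * (r + s)"
    and tk: "trivial_kernel ({..<s} \<times> {..<Q}) ({..<r + s} \<times> {..<P}) (\<lambda>(k,z) (j,x). \<Sum>i\<le>N. mulmat g i k j * A i z x)"
    and W: "csubspace W" "W \<subseteq> S (s - 1)"
  shows "eta (r + s) (prodsp (cspan (g ` {..<N + 1})) W) \<ge> eta s W"
proof -
  define U where "U = prodsp (cspan (g ` {..<N + 1})) W"
  have spanW: "cspan W = W" using W(1) by simp
  have "U \<subseteq> S (r + s - 1)" unfolding U_def
  proof (subst spanW[symmetric], rule prodsp_subset[OF csubspace_S])
    fix f h assume "f \<in> g ` {..<N + 1}" "h \<in> W"
    then have "degree f \<le> r" "degree h \<le> s - 1" using g W(2) by (auto simp: S_def)
    then show "f * h \<in> S (r + s - 1)" using degree_mult_le[of f h] s by (auto simp: S_def)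
  qed
  then obtain Y where Y: "Y \<subseteq> U" "finite Y" "cpoly.independent Y" "U \<subseteq> cspan Y" "card Y = cdim U"
    by (rule finite_basis)
  obtain B where B: "B \<subseteq> W" "finite B" "cpoly.independent B" "W \<subseteq> cspan B" "card B = cdim W"
    using finite_basis[OF W(2)] by blast
  have degB: "degree p < s" if "p \<in> B" for p
    using that B(1) W(2) s by (force simp: S_def)
  have "\<exists>c. g i * p = (\<Sum>y\<in>Y. Polynomial.smult (c y) y)" if "i \<le> N" "p \<in> B" for i p
  proof -
    have "g i * p \<in> U" unfolding U_def prodsp_def
    proof (rule cpoly.span_base)
      have "g i \<in> cspan (g ` {..<N + 1})" using that(1) by (intro cpoly.span_base imageI) simp
      moreover have "p \<in> W" using that(2) B(1) by blast
      ultimately show "g i * p \<in> {f * h | f h. f \<in> cspan (g ` {..<N + 1}) \<and> h \<in> W}" by blast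
    qed
    then have "g i * p \<in> cspan Y" using Y(4) by blast
    then show ?thesis by (auto simp: cpoly.span_finite[OF Y(2)])
  qed
  then obtain c where c: "\<And>i p. i \<le> N \<Longrightarrow> p \<in> B \<Longrightarrow> g i * p = (\<Sum>y\<in>Y. Polynomial.smult (c i p y) y)" by metis
  \<comment> \<open>The certificate restricted to W and written in the bases \<open>B\<close> and
    \<open>Y\<close>. A kernel vector, rewritten in monomial coordinates as \<open>v\<close>, is
    killed by the full certificate.\<close>
  have "trivial_kernel (B \<times> {..<Q}) (Y \<times> {..<P}) (\<lambda>(y,z) (p,x). \<Sum>i\<le>N. c i p y * A i z x)"
  proof (rule trivial_kernelI)
    fix u q
    assume u: "\<And>t. t \<in> Y \<times> {..<P} \<Longrightarrow>
        (\<Sum>q\<in>B \<times> {..<Q}. (\<lambda>(y,z) (p,x). \<Sum>i\<le>N. c i p y * A i z x) t q * u q) = 0"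
      and q: "q \<in> B \<times> {..<Q}"
    obtain p0 x0 where q': "q = (p0,x0)" "p0 \<in> B" "x0 < Q" using q by auto
    have u': "(\<Sum>x<Q. \<Sum>i\<le>N. \<Sum>p\<in>B. c i p y * (A i z x * u (p,x))) = 0" if "y \<in> Y" "z < P" for y z
    proof -
      have "(\<Sum>q\<in>B \<times> {..<Q}. (\<Sum>i\<le>N. c i (fst q) y * A i z (snd q)) * u q) = 0"
        using u[of "(y,z)"] that by (simp add: case_prod_unfold)
      moreover have "(\<Sum>q\<in>B \<times> {..<Q}. (\<Sum>i\<le>N. c i (fst q) y * A i z (snd q)) * u q)
        = (\<Sum>p\<in>B. \<Sum>x<Q. \<Sum>i\<le>N. c i p y * (A i z x * u (p,x)))"
        by (subst sum.cartesian_product) (auto intro!: sum.cong simp: sum_distrib_right mult.assoc)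
      moreover have "\<dots> = (\<Sum>x<Q. \<Sum>p\<in>B. \<Sum>i\<le>N. c i p y * (A i z x * u (p,x)))" by (rule sum.swap)
      moreover have "\<dots> = (\<Sum>x<Q. \<Sum>i\<le>N. \<Sum>p\<in>B. c i p y * (A i z x * u (p,x)))"
        by (rule sum.cong[OF refl], rule sum.swap)
      ultimately show ?thesis by simp
    qed
    define v where "v = (\<lambda>(j,x). \<Sum>p\<in>B. coeff p j * u (p,x))"
    have v0: "v (j,x) = 0" if jx: "(j,x) \<in> {..<s} \<times> {..<Q}" for j x
    proof (rule trivial_kernelD[OF tk _ jx])
      fix t assume "t \<in> {..<r + s} \<times> {..<P}"
      then obtain k z where t: "t = (k,z)" "k < r + s" "z < P" by auto
      have "(\<Sum>q\<in>{..<s} \<times> {..<Q}. (\<Sum>i\<le>N. mulmat g i k (fst q) * A i z (snd q)) * v q)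
        = (\<Sum>j<s. \<Sum>x<Q. \<Sum>i\<le>N. \<Sum>p\<in>B. mulmat g i k j * coeff p j * (A i z x * u (p,x)))"
        by (subst sum.cartesian_product)
          (auto intro!: sum.cong simp: v_def sum_distrib_right sum_distrib_left mult_ac)
      also have "\<dots> = (\<Sum>x<Q. \<Sum>j<s. \<Sum>i\<le>N. \<Sum>p\<in>B. mulmat g i k j * coeff p j * (A i z x * u (p,x)))"
        by (rule sum.swap)
      also have "\<dots> = (\<Sum>x<Q. \<Sum>i\<le>N. \<Sum>j<s. \<Sum>p\<in>B. mulmat g i k j * coeff p j * (A i z x * u (p,x)))"
        by (rule sum.cong[OF refl], rule sum.swap)
      also have "\<dots> = (\<Sum>x<Q. \<Sum>i\<le>N. \<Sum>p\<in>B. \<Sum>j<s. mulmat g i k j * coeff p j * (A i z x * u (p,x)))"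
        by (rule sum.cong[OF refl], rule sum.cong[OF refl], rule sum.swap)
      also have "\<dots> = (\<Sum>x<Q. \<Sum>i\<le>N. \<Sum>p\<in>B. \<Sum>y\<in>Y. coeff y k * (c i p y * (A i z x * u (p,x))))"
      proof (intro sum.cong refl)
        fix x i p assume ip: "i \<in> {..N}" "p \<in> B"
        have "(\<Sum>j<s. mulmat g i k j * coeff p j * (A i z x * u (p,x))) = coeff (g i * p) k * (A i z x * u (p,x))"
          by (simp add: coeff_mult_mulmat[OF degB[OF ip(2)]] sum_distrib_right)
        also have "\<dots> = (\<Sum>y\<in>Y. coeff y k * (c i p y * (A i z x * u (p,x))))"
          using c[of i p] ip by (simp add: coeff_sum sum_distrib_left sum_distrib_right mult_ac)
        finally show "(\<Sum>j<s. mulmat g i k j * coeff p j * (A i z x * u (p,x)))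
          = (\<Sum>y\<in>Y. coeff y k * (c i p y * (A i z x * u (p,x))))" .
      qed
      also have "\<dots> = (\<Sum>x<Q. \<Sum>i\<le>N. \<Sum>y\<in>Y. \<Sum>p\<in>B. coeff y k * (c i p y * (A i z x * u (p,x))))"
        by (rule sum.cong[OF refl], rule sum.cong[OF refl], rule sum.swap)
      also have "\<dots> = (\<Sum>x<Q. \<Sum>y\<in>Y. \<Sum>i\<le>N. \<Sum>p\<in>B. coeff y k * (c i p y * (A i z x * u (p,x))))"
        by (rule sum.cong[OF refl], rule sum.swap)
      also have "\<dots> = (\<Sum>y\<in>Y. \<Sum>x<Q. \<Sum>i\<le>N. \<Sum>p\<in>B. coeff y k * (c i p y * (A i z x * u (p,x))))"
        by (rule sum.swap)
      also have "\<dots> = (\<Sum>y\<in>Y. coeff y k * (\<Sum>x<Q. \<Sum>i\<le>N. \<Sum>p\<in>B. c i p y * (A i z x * u (p,x))))"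
        by (simp only: sum_distrib_left)
      also have "\<dots> = 0" using u' t by simp
      finally show "(\<Sum>q\<in>{..<s} \<times> {..<Q}. (\<lambda>(k,z) (j,x). \<Sum>i\<le>N. mulmat g i k j * A i z x) t q * v q) = 0"
        by (simp only: t case_prod_unfold fst_conv snd_conv)
    qed
    have "(\<Sum>p\<in>B. Polynomial.smult (u (p,x0)) p) = 0"
    proof (rule poly_eqI)
      fix j
      have "(\<Sum>p\<in>B. u (p,x0) * coeff p j) = 0"
      proof (cases "j < s")
        case True
        then show ?thesis using v0[of j x0] q'(3) by (simp add: v_def mult.commute)
      next
        case False
        then have "coeff p j = 0" if "p \<in> B" for p using degB[OF that] by (intro coeff_eq_0) simp
        then show ?thesis by simp
      qed
      then show "coeff (\<Sum>p\<in>B. Polynomial.smult (u (p,x0)) p) j = coeff 0 j" by (simp add: coeff_sum)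
    qed
    then show "u q = 0"
      using cpoly.independentD[OF B(3,2) order_refl, of "\<lambda>p. u (p,x0)" p0] q' by simp
  qed
  then have "card (B \<times> {..<Q}) \<le> card (Y \<times> {..<P})"
    using B(2) Y(2) by (intro trivial_kernel_card_le) auto
  then have le: "cdim W * Q \<le> cdim U * P" by (simp add: card_cartesian_product B(5) Y(5))
  have "P * (cdim W * (r + s)) = cdim W * Q * s" using PQ(2) by (simp add: mult_ac)
  also have "\<dots> \<le> P * (cdim U * s)" using mult_right_mono[OF le, of s] by (simp add: mult_ac)
  finally have "cdim W * (r + s) \<le> cdim U * s" using PQ(1) by simp
  then have "real (cdim W) * real (r + s) \<le> real (cdim U) * real s" by (metis of_nat_le_iff of_nat_mult)
  then show ?thesis using s unfolding eta_def U_def[symmetric] by (simp add: field_simps)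
qed

text \<open>Reads the columns of \<open>X\<close> and \<open>Y\<close> as coefficient vectors of
  forms. The conclusion is reached for every tuple \<open>g\<close>, not only for a general
  one.\<close>

lemma destabilised:
  assumes g: "\<And>i. i \<le> N \<Longrightarrow> degree (g i) \<le> r" and "N \<ge> 2" "r > 0" "s > 0"
    and notin: "real s / real r \<notin> Phi N"
  shows "\<exists>W. csubspace W \<and> W \<subseteq> S (s - 1) \<and> W \<noteq> {0} \<and>
    eta (r + s) (prodsp (cspan (g ` {..<N + 1})) W) < eta s W"
proof -
  obtain w m C and X Y :: "nat \<Rightarrow> nat \<Rightarrow> complex" where w: "0 < w" "m * s < (r + s) * w"
    and tk: "trivial_kernel {..<w} {..<s} X"
    and XY: "\<And>i a k. i \<le> N \<Longrightarrow> a < w \<Longrightarrow> k < r + s \<Longrightarrow>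
      (\<Sum>j<s. mulmat g i k j * X j a) = (\<Sum>b<m. Y k b * (C i b a :: complex))"
    using destabilising_subspace[of N s "r + s" "mulmat g"] assms by auto
  define p where "p a = (\<Sum>j<s. monom (X j a) j)" for a
  define y where "y b = (\<Sum>k<r + s. monom (Y k b) k)" for b
  define W where "W = cspan (p ` {..<w})"
  have coeff_p: "coeff (p a) j = (if j < s then X j a else 0)" for a j
    by (simp add: p_def coeff_sum)
  have coeff_y: "coeff (y b) k = (if k < r + s then Y k b else 0)" for b k
    by (simp add: y_def coeff_sum)
  have degp: "degree (p a) \<le> s - 1" for a by (intro degree_le) (auto simp: coeff_p)
  have dimW: "cdim W = w" unfolding W_def
  proof (rule cdim_span_family)
    fix c :: "nat \<Rightarrow> complex" and a
    assume c: "(\<Sum>a<w. Polynomial.smult (c a) (p a)) = 0" and a: "a < w"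
    then have a': "a \<in> {..<w}" by simp
    have "(\<Sum>a<w. X j a * c a) = 0" if "j \<in> {..<s}" for j
      using arg_cong[OF c, of "\<lambda>q. coeff q j"] that by (simp add: coeff_sum coeff_p mult.commute)
    then show "c a = 0" by (rule trivial_kernelD[OF tk _ a'])
  qed
  have W: "W \<subseteq> S (s - 1)" unfolding W_def
    using degp by (intro cpoly.span_minimal csubspace_S) (auto simp: S_def)
  have prod: "g i * p a = (\<Sum>b<m. Polynomial.smult (C i b a) (y b))" if "i \<le> N" "a < w" for i a
  proof (rule poly_eqI)
    fix k
    have "degree (g i * p a) < r + s"
      using degree_mult_le[of "g i" "p a"] g[OF that(1)] degp[of a] \<open>s > 0\<close> by linarith
    then have "coeff (g i * p a) k = 0" if "\<not> k < r + s" using that by (intro coeff_eq_0) simp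
    moreover have "coeff (g i * p a) k = (\<Sum>j<s. mulmat g i k j * X j a)"
      using degp[of a] \<open>s > 0\<close> by (subst coeff_mult_mulmat[of _ s]) (auto simp: coeff_p)
    ultimately show "coeff (g i * p a) k = coeff (\<Sum>b<m. Polynomial.smult (C i b a) (y b)) k"
      using XY[OF that, of k] by (cases "k < r + s") (simp_all add: coeff_sum coeff_y mult.commute)
  qed
  have "prodsp (cspan (g ` {..<N + 1})) W \<subseteq> cspan (y ` {..<m})" unfolding W_def
  proof (rule prodsp_subset[OF cpoly.subspace_span])
    fix f h assume "f \<in> g ` {..<N + 1}" "h \<in> p ` {..<w}"
    then obtain i a where "i \<in> {..<N + 1}" "a \<in> {..<w}" "f = g i" "h = p a" by blast
    then have "f * h = (\<Sum>b<m. Polynomial.smult (C i b a) (y b))" by (simp add: prod)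
    also have "\<dots> \<in> cspan (y ` {..<m})"
      by (intro cpoly.span_sum cpoly.span_scale cpoly.span_base imageI)
    finally show "f * h \<in> cspan (y ` {..<m})" .
  qed
  then have "cdim (prodsp (cspan (g ` {..<N + 1})) W) \<le> card (y ` {..<m})"
    by (rule cpoly.dim_le_card) simp
  also have "\<dots> \<le> m" using card_image_le[of "{..<m}" y] by simp
  finally have "cdim (prodsp (cspan (g ` {..<N + 1})) W) * s < (r + s) * w"
    using w(2) by (meson le_less_trans mult_le_mono1)
  then have "real (cdim (prodsp (cspan (g ` {..<N + 1})) W)) * real s < real (r + s) * real w"
    by (metis of_nat_less_iff of_nat_mult)
  then have "eta (r + s) (prodsp (cspan (g ` {..<N + 1})) W) < eta s W"
    using \<open>s > 0\<close> by (simp add: eta_def dimW field_simps)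
  moreover have "W \<noteq> {0}"
  proof
    assume "W = {0}"
    then have "cdim W \<le> card ({} :: complex poly set)" by (intro cpoly.dim_le_card) auto
    then show False using dimW w(1) by simp
  qed
  moreover have "csubspace W" by (simp add: W_def)
  ultimately show ?thesis using W by blast
qed

section \<open>Degeneration of binary forms to a staircase\<close>

lemma coeff_tuple_form: "coeff (tuple_form r x i) l = (if l \<le> r then x (i * (r + 1) + l) else 0)"
  by (simp add: tuple_form_def coeff_sum)

lemma degree_tuple_form: "degree (tuple_form r x i) \<le> r"
  by (intro degree_le) (simp add: coeff_tuple_form)

lemma mulmat_tuple_form:
  "mulmat (tuple_form r x) i k j = (if j \<le> k \<and> k - j \<le> r then x (i * (r + 1) + (k - j)) else 0)"
  by (simp add: mulmat_def coeff_monom_mult coeff_tuple_form)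

text \<open>The tropical distance of (j, k) from the path: jk = (j^2 + k^2 - (k - j)^2) / 2, so by the next lemma
  2 * excess differs from (k - j)^2 by a function of j plus a function of k.  The truncated subtractions are
  positive parts.\<close>

definition excess :: "nat \<Rightarrow> nat \<Rightarrow> nat \<Rightarrow> nat \<Rightarrow> nat" where
  "excess s n j k = (\<Sum>t\<in>{1..j}. t * n div s - k) + (\<Sum>t\<in>{j<..<s}. k - t * n div s)"

text \<open>For \<open>t \<le> j\<close> both sides contain the maximum of k and
  \<open>t * n div s\<close>, as a positive part plus the number subtracted. In the language of
  optimal transport with cost \<open>(k - j)^2\<close>, the sums on the right give, together with
  the squares, dual potentials, and \<open>2 * excess\<close> is the reduced cost.\<close>

lemma excess_potential:
  assumes "j < s"
  shows "excess s n j k + j * k = (\<Sum>t\<in>{1..j}. t * n div s) + (\<Sum>t\<in>{1..<s}. k - t * n div s)"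
proof -
  have "{1..<s} = {1..j} \<union> {j<..<s}" "{1..j} \<inter> {j<..<s} = {}" using assms by auto
  then have "(\<Sum>t\<in>{1..<s}. k - t * n div s)
      = (\<Sum>t\<in>{1..j}. k - t * n div s) + (\<Sum>t\<in>{j<..<s}. k - t * n div s)"
    by (simp add: sum.union_disjoint)
  moreover have "(\<Sum>t\<in>{1..j}. t * n div s - k) + j * k = (\<Sum>t\<in>{1..j}. (t * n div s - k) + k)"
    by (simp add: sum.distrib)
  moreover have "\<dots> = (\<Sum>t\<in>{1..j}. t * n div s + (k - t * n div s))" by (intro sum.cong) auto
  ultimately show ?thesis by (simp add: excess_def sum.distrib)
qed

text \<open>The thresholds increase with t, so only \<open>t = j\<close> and
  \<open>t = j + 1\<close> matter. Coprimality makes the second inequality strict, and for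
  \<open>j = s - 1\<close> the bound \<open>k < n\<close> takes its place.\<close>

lemma excess_eq_0_iff:
  assumes "coprime s n" "j < s" "k < n"
  shows "excess s n j k = 0 \<longleftrightarrow> edge s n j k"
proof -
  have s: "s > 0" using assms(2) by simp
  have mono: "t * n div s \<le> t' * n div s" if "t \<le> t'" for t t' using that by (intro div_le_mono mult_right_mono) auto
  have "excess s n j k = 0 \<longleftrightarrow> (\<forall>t\<in>{1..j}. t * n div s \<le> k) \<and> (\<forall>t\<in>{j<..<s}. k \<le> t * n div s)"
    by (simp add: excess_def)
  moreover have "(\<forall>t\<in>{1..j}. t * n div s \<le> k) \<longleftrightarrow> j * n < (k + 1) * s"
  proof -
    have "(\<forall>t\<in>{1..j}. t * n div s \<le> k) \<longleftrightarrow> j * n div s \<le> k"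
    proof
      assume "\<forall>t\<in>{1..j}. t * n div s \<le> k"
      then show "j * n div s \<le> k" by (cases "j = 0") auto
    next
      assume "j * n div s \<le> k"
      then show "\<forall>t\<in>{1..j}. t * n div s \<le> k" using mono by (meson atLeastAtMost_iff order_trans)
    qed
    also have "\<dots> \<longleftrightarrow> j * n div s < k + 1" by auto
    also have "\<dots> \<longleftrightarrow> j * n < (k + 1) * s" using s by (simp add: div_less_iff_less_mult)
    finally show ?thesis .
  qed
  moreover have "(\<forall>t\<in>{j<..<s}. k \<le> t * n div s) \<longleftrightarrow> k * s < (j + 1) * n"
  proof (cases "Suc j < s")
    case True
    have "(\<forall>t\<in>{j<..<s}. k \<le> t * n div s) \<longleftrightarrow> k \<le> Suc j * n div s"
    proof
      assume "\<forall>t\<in>{j<..<s}. k \<le> t * n div s"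
      with True show "k \<le> Suc j * n div s" by (meson greaterThanLessThan_iff lessI)
    next
      assume *: "k \<le> Suc j * n div s"
      show "\<forall>t\<in>{j<..<s}. k \<le> t * n div s"
      proof
        fix t assume "t \<in> {j<..<s}"
        then have "Suc j * n div s \<le> t * n div s" by (intro mono) simp
        with * show "k \<le> t * n div s" by (rule order_trans)
      qed
    qed
    also have "\<dots> \<longleftrightarrow> k * s \<le> Suc j * n" using s by (simp add: less_eq_div_iff_mult_less_eq)
    also have "\<dots> \<longleftrightarrow> k * s < Suc j * n"
    proof -
      have "\<not> s dvd Suc j * n"
        using assms(1) True by (metis coprime_dvd_mult_left_iff nat_dvd_not_less zero_less_Suc)
      then have "k * s \<noteq> Suc j * n" by (metis dvd_triv_right)
      then show ?thesis by linarith
    qed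
    finally show ?thesis by simp
  next
    case False
    then have "s = j + 1" using assms(2) by simp
    moreover from this have "{j<..<s} = {}" by auto
    moreover have "k * s < n * s" using assms(3) s by simp
    ultimately show ?thesis by (simp add: mult.commute)
  qed
  ultimately show ?thesis by (auto simp: edge_def)
qed

text \<open>The path stays in the band where multiplication by forms of degree r can have nonzero
  entries, so the limit keeps every edge.\<close>

lemma edge_range:
  assumes "edge s (r + s) j k" "j < s"
  shows "j \<le> k" "k - j \<le> r"
proof -
  have 1: "k * s < (j + 1) * (r + s)" and 2: "j * (r + s) < (k + 1) * s" using assms(1) by (auto simp: edge_def)
  have "j * s < (k + 1) * s" using 2 by (simp add: algebra_simps)
  then show "j \<le> k" by (metis Suc_eq_plus1 less_Suc_eq_le mult_less_cancel2)
  have "(j + 1) * r \<le> s * r" using assms(2) by (intro mult_right_mono) auto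
  then have "k * s < (j + 1 + r) * s" using 1 by (simp add: algebra_simps)
  then have "k < j + 1 + r" by (metis mult_less_cancel2)
  then show "k - j \<le> r" by simp
qed

text \<open>For the forms with exponents tau^(l^2), the entry at (j, k) is tau^(2 * excess) after rescaling rows
  and columns.\<close>

lemma degeneration_to_stair:
  fixes A :: "nat \<Rightarrow> nat \<Rightarrow> nat \<Rightarrow> complex"
  assumes cop: "coprime s (r + s)" and PQ: "Q * s = P * (r + s)"
    and tk: "trivial_kernel ({..<s} \<times> {..<Q}) ({..<r + s} \<times> {..<P})
      (\<lambda>(k,z) (j,y). \<Sum>i\<le>N. stair N s (r + s) 1 (-1) 0 i k j * A i z y)"
  shows "\<exists>x. trivial_kernel ({..<s} \<times> {..<Q}) ({..<r + s} \<times> {..<P})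
      (\<lambda>(k,z) (j,y). \<Sum>i\<le>N. mulmat (tuple_form r x) i k j * A i z y)"
proof -
  \<comment> \<open>The rescaled matrix is polynomial in \<open>t\<close> and makes sense at
    \<open>t = 0\<close>, where \<open>0 ^ 0 = 1\<close> leaves exactly the path.\<close>
  define X :: "complex \<Rightarrow> nat \<times> nat \<Rightarrow> nat \<times> nat \<Rightarrow> complex" where "X t = (\<lambda>(k,z) (j,y). \<Sum>i\<le>N.
    (if j \<le> k \<and> k - j \<le> r \<and> (k - j) mod (N + 1) = i then t ^ (2 * excess s (r + s) j k) else 0) * A i z y)" for t
  have "X 0 (k,z) (j,y) = (\<Sum>i\<le>N. stair N s (r + s) 1 (-1) 0 i k j * A i z y)" if "j < s" "k < r + s" for k z j y
  proof -
    have "(if j \<le> k \<and> k - j \<le> r \<and> (k - j) mod (N + 1) = i then (0::complex) ^ (2 * excess s (r + s) j k) else 0)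
      = stair N s (r + s) 1 (-1) 0 i k j" for i
    proof (cases "edge s (r + s) j k")
      case True
      have "colour N 1 (-1) 0 j k = (k - j) mod (N + 1)"
        using edge_range(1)[OF True that(1)] by (simp add: colour_def nat_mod_as_int of_nat_diff add.commute)
      then show ?thesis using True edge_range[OF True that(1)] excess_eq_0_iff[OF cop that]
        by (auto simp: stair_def)
    next
      case False
      then have "excess s (r + s) j k > 0" using excess_eq_0_iff[OF cop that] by simp
      then show ?thesis using False by (simp add: stair_def)
    qed
    then show ?thesis by (simp add: X_def)
  qed
  then have "trivial_kernel ({..<s} \<times> {..<Q}) ({..<r + s} \<times> {..<P}) (X 0)"
    using tk by (subst trivial_kernel_cong) auto
  moreover have "\<exists>p. \<forall>t. poly p t \<noteq> 0 \<longleftrightarrow> trivial_kernel ({..<s} \<times> {..<Q}) ({..<r + s} \<times> {..<P}) (X t)"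
  proof (rule poly_trivial_kernel)
    show "card ({..<s} \<times> {..<Q}) = card ({..<r + s} \<times> {..<P})" using PQ by (simp add: card_cartesian_product mult.commute)
    fix q c :: "nat \<times> nat"
    obtain k z j y where qc: "q = (k,z)" "c = (j,y)" by fastforce
    show "\<exists>p. \<forall>t. X t q c = poly p t"
      by (rule exI[of _ "\<Sum>i\<le>N. [:A i z y:] * (if j \<le> k \<and> k - j \<le> r \<and> (k - j) mod (N + 1) = i
          then monom 1 (2 * excess s (r + s) j k) else 0)"])
        (auto simp: X_def qc poly_sum poly_monom intro!: sum.cong)
  qed auto
  then obtain p where p: "\<And>t. poly p t \<noteq> 0 \<longleftrightarrow> trivial_kernel ({..<s} \<times> {..<Q}) ({..<r + s} \<times> {..<P}) (X t)" by blast
  ultimately have "poly p 0 \<noteq> 0" by blast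
  then have "\<exists>t. poly p t \<noteq> 0" by blast
  \<comment> \<open>Zero is avoided so that rescaling by powers of \<open>\<tau>\<close> is
    invertible and leads back to actual forms.\<close>
  then obtain \<tau> where "\<tau> \<noteq> 0" "poly p \<tau> \<noteq> 0"
    using exists_common_nonroot[of "{()}" "\<lambda>_. p" "{0}"] by auto
  then have \<tau>: "\<tau> \<noteq> 0" "trivial_kernel ({..<s} \<times> {..<Q}) ({..<r + s} \<times> {..<P}) (X \<tau>)" using p by auto
  define a where "a j = (\<Sum>t\<in>{1..j}. t * (r + s) div s)" for j
  define b where "b k = (\<Sum>t\<in>{1..<s}. k - t * (r + s) div s)" for k
  define d where "d k = \<tau> ^ k\<^sup>2 / \<tau> ^ (2 * b k)" for k
  define e where "e j = \<tau> ^ j\<^sup>2 / \<tau> ^ (2 * a j)" for j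
  \<comment> \<open>The coefficients of the forms \<open>f i\<close>, stored at
    \<open>q = i * (r + 1) + l\<close>.\<close>
  define x where "x q = (if (q mod (r + 1)) mod (N + 1) = q div (r + 1) then \<tau> ^ (q mod (r + 1))\<^sup>2 else 0)" for q
  have x: "x (i * (r + 1) + l) = (if l mod (N + 1) = i then \<tau> ^ l\<^sup>2 else 0)" if "l \<le> r" for i l
    unfolding x_def using that by (simp del: mult_Suc_right)
  have "trivial_kernel ({..<s} \<times> {..<Q}) ({..<r + s} \<times> {..<P}) (\<lambda>q c. d (fst q) * e (fst c) * X \<tau> q c)"
    by (rule trivial_kernel_scale[OF \<tau>(2)]) (use \<tau>(1) in \<open>auto simp: d_def e_def\<close>)
  moreover have "d k * e j * X \<tau> (k,z) (j,y) = (\<Sum>i\<le>N. mulmat (tuple_form r x) i k j * A i z y)"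
    if "j < s" for k z j y
  proof -
    have "d k * e j * (if j \<le> k \<and> k - j \<le> r \<and> (k - j) mod (N + 1) = i then \<tau> ^ (2 * excess s (r + s) j k) else 0)
      = mulmat (tuple_form r x) i k j" for i
    proof (cases "j \<le> k \<and> k - j \<le> r \<and> (k - j) mod (N + 1) = i")
      case True
      define l where "l = k - j"
      have k: "k = j + l" using True by (simp add: l_def)
      have "excess s (r + s) j k + j * k = a j + b k" using excess_potential[OF that] by (simp add: a_def b_def)
      then have "k\<^sup>2 + j\<^sup>2 + 2 * excess s (r + s) j k = l\<^sup>2 + 2 * b k + 2 * a j"
        unfolding k by (simp add: power2_eq_square algebra_simps)
      then have "\<tau> ^ k\<^sup>2 * \<tau> ^ j\<^sup>2 * \<tau> ^ (2 * excess s (r + s) j k) = \<tau> ^ l\<^sup>2 * \<tau> ^ (2 * b k) * \<tau> ^ (2 * a j)"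
        by (simp only: power_add[symmetric])
      then have "d k * e j * \<tau> ^ (2 * excess s (r + s) j k) = \<tau> ^ l\<^sup>2"
        using \<tau>(1) by (simp add: d_def e_def field_simps)
      then show ?thesis using True unfolding mulmat_tuple_form l_def[symmetric] by (simp only: x) simp
    next
      case False
      then have "mulmat (tuple_form r x) i k j = 0"
        unfolding mulmat_tuple_form using x[of "k - j" i] by (cases "j \<le> k \<and> k - j \<le> r") (simp_all only:, auto)
      then show ?thesis by (simp only: if_not_P[OF False] mult_zero_right)
    qed
    then show ?thesis by (simp add: X_def sum_distrib_left flip: mult.assoc)
  qed
  ultimately have "trivial_kernel ({..<s} \<times> {..<Q}) ({..<r + s} \<times> {..<P})
      (\<lambda>(k,z) (j,y). \<Sum>i\<le>N. mulmat (tuple_form r x) i k j * A i z y)"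
    by (subst trivial_kernel_cong[symmetric]) auto
  then show ?thesis by blast
qed

section \<open>Generic tuples of forms and the equivalence\<close>

lemma polyfun_index: "i \<le> N \<Longrightarrow> l \<le> r \<Longrightarrow> polyfun ((N + 1) * (r + 1)) (\<lambda>x. x (i * (r + 1) + l))"
proof (rule polyfun.var)
  assume "i \<le> N" "l \<le> r"
  then have "i * (r + 1) \<le> N * (r + 1)" by (intro mult_right_mono) auto
  with \<open>l \<le> r\<close> show "i * (r + 1) + l < (N + 1) * (r + 1)" by simp
qed

text \<open>\<open>G\<close> is the minor of the coefficients of degrees 0, ..., N. It is nonzero at
  the tuple of these monomials, which lie in \<open>S r\<close> because
  \<open>N \<le> r\<close>.\<close>

lemma general_independence:
  assumes "N \<le> r"
  shows "\<exists>G. polyfun ((N + 1) * (r + 1)) G \<and> (\<exists>x. G x \<noteq> 0) \<and>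
    (\<forall>x. G x \<noteq> 0 \<longrightarrow> cdim (span_of_coeffs (N + 1) r x) = N + 1)"
proof -
  have "\<exists>G. polyfun ((N + 1) * (r + 1)) G \<and>
    (\<forall>x. G x \<noteq> 0 \<longleftrightarrow> trivial_kernel {..N} {..N} (\<lambda>l i. x (i * (r + 1) + l)))"
    using assms by (intro polyfun_trivial_kernel polyfun_index) auto
  then obtain G where G: "polyfun ((N + 1) * (r + 1)) G"
    "\<And>x. G x \<noteq> 0 \<longleftrightarrow> trivial_kernel {..N} {..N} (\<lambda>l i. x (i * (r + 1) + l))" by blast
  define x0 :: "nat \<Rightarrow> complex" where "x0 q = (if q mod (r + 1) = q div (r + 1) then 1 else 0)" for q
  have x0: "x0 (i * (r + 1) + l) = (if l = i then 1 else 0)" if "l \<le> N" for i l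
    unfolding x0_def using that assms by (simp del: mult_Suc_right)
  have "trivial_kernel {..N} {..N} (\<lambda>l i. x0 (i * (r + 1) + l))"
  proof (rule trivial_kernelI)
    fix v l assume v: "\<And>q. q \<in> {..N} \<Longrightarrow> (\<Sum>i\<le>N. x0 (i * (r + 1) + q) * v i) = 0" and l: "l \<in> {..N}"
    have "(\<Sum>i\<le>N. x0 (i * (r + 1) + l) * v i) = (\<Sum>i\<le>N. if i = l then v i else 0)"
      using l by (intro sum.cong refl) (simp only: x0 atMost_iff, simp)
    then show "v l = 0" using v[OF l] l by simp
  qed
  then have "G x0 \<noteq> 0" using G(2) by blast
  moreover have "cdim (span_of_coeffs (N + 1) r x) = N + 1" if "G x \<noteq> 0" for x
    unfolding span_of_coeffs_def
  proof (rule cdim_span_family)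
    fix c :: "nat \<Rightarrow> complex" and i
    assume c: "(\<Sum>i<N + 1. Polynomial.smult (c i) (tuple_form r x i)) = 0" and i: "i < N + 1"
    have "(\<Sum>i\<le>N. x (i * (r + 1) + l) * c i) = 0" if "l \<in> {..N}" for l
    proof -
      have "(\<Sum>i<N + 1. c i * coeff (tuple_form r x i) l) = 0"
        using arg_cong[OF c, of "\<lambda>q. coeff q l"] by (simp add: coeff_sum)
      then show ?thesis using that assms
        by (simp add: coeff_tuple_form lessThan_Suc_atMost mult.commute del: sum.lessThan_Suc mult_Suc_right)
    qed
    then show "c i = 0" using i trivial_kernelD[OF G(2)[THEN iffD1, OF that], of c i] by auto
  qed
  ultimately show ?thesis using G(1) by blast
qed

theorem theorem1p2:
  fixes N r s :: nat
  assumes "N \<ge> 2" and "r > 0" and "s > 0" and "coprime r s" and "N \<le> r"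
  shows "general_subspace (N + 1) r
           (\<lambda>V. (\<forall>W. csubspace W \<and> W \<subseteq> S (s - 1) \<and> W \<noteq> {0} \<longrightarrow>
                    eta (r + s) (prodsp V W) \<ge> eta s W)
                \<longleftrightarrow> real s / real r \<in> Phi N)"
proof -
  obtain G x1 where G: "polyfun ((N + 1) * (r + 1)) G" "G x1 \<noteq> 0"
    "\<And>x. G x \<noteq> 0 \<Longrightarrow> cdim (span_of_coeffs (N + 1) r x) = N + 1"
    using general_independence[OF assms(5)] by blast
  show ?thesis
  proof (cases "real s / real r \<in> Phi N")
    case False
    \<comment> \<open>Outside \<open>Phi N\<close> every tuple is destabilised, so the open set only
      has to ensure dimension N + 1.\<close>
    have "\<not> (\<forall>W. csubspace W \<and> W \<subseteq> S (s - 1) \<and> W \<noteq> {0} \<longrightarrow>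
        eta (r + s) (prodsp (span_of_coeffs (N + 1) r x) W) \<ge> eta s W)" for x
      using destabilised[of N "tuple_form r x" r s, OF degree_tuple_form assms(1-3) False]
      unfolding span_of_coeffs_def by (meson not_le)
    then show ?thesis using G False unfolding general_subspace_def general_pt_def by blast
  next
    case True
    have cop: "coprime s (r + s)" using assms(4) by (simp add: coprime_iff_gcd_eq_1 gcd.commute[of s])
    have "cert N s (r + s) (stair N s (r + s) 1 (-1) 0)"
      using cert_stair[OF assms(1) cop assms(3), of 1 "-1" 0] assms(2) True by simp
    then obtain P Q and A :: "nat \<Rightarrow> nat \<Rightarrow> nat \<Rightarrow> complex" where PQ: "P > 0" "Q * s = P * (r + s)"
      and tk: "trivial_kernel ({..<s} \<times> {..<Q}) ({..<r + s} \<times> {..<P})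
        (\<lambda>(k,z) (j,y). \<Sum>i\<le>N. stair N s (r + s) 1 (-1) 0 i k j * A i z y)"
      unfolding cert_def by blast
    \<comment> \<open>With \<open>A\<close> fixed, the entries are linear in the coefficients of the
      forms, so the determinant is a polynomial function of the tuple.\<close>
    define T where "T x = (\<lambda>(k,z) (j,y). \<Sum>i\<le>N. mulmat (tuple_form r x) i k j * A i z y)" for x
    obtain x2 where x2: "trivial_kernel ({..<s} \<times> {..<Q}) ({..<r + s} \<times> {..<P}) (T x2)"
      using degeneration_to_stair[OF cop PQ(2) tk] unfolding T_def by blast
    have "\<exists>D. polyfun ((N + 1) * (r + 1)) D \<and>
      (\<forall>x. D x \<noteq> 0 \<longleftrightarrow> trivial_kernel ({..<s} \<times> {..<Q}) ({..<r + s} \<times> {..<P}) (T x))"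
    proof (rule polyfun_trivial_kernel)
      show "card ({..<s} \<times> {..<Q}) = card ({..<r + s} \<times> {..<P})" using PQ by (simp add: card_cartesian_product mult.commute)
      fix q c :: "nat \<times> nat"
      obtain k z j y where qc: "q = (k,z)" "c = (j,y)" by fastforce
      have "polyfun ((N + 1) * (r + 1)) (\<lambda>x. mulmat (tuple_form r x) i k j)" if "i \<le> N" for i
        unfolding mulmat_tuple_form using polyfun_index[OF that, of "k - j" r]
        by (cases "j \<le> k \<and> k - j \<le> r") (auto intro: polyfun.const)
      then show "polyfun ((N + 1) * (r + 1)) (\<lambda>x. T x q c)"
        unfolding T_def qc prod.case by (intro polyfun_sum polyfun.mult polyfun.const) auto
    qed auto
    then obtain D where D: "polyfun ((N + 1) * (r + 1)) D"
      "\<And>x. D x \<noteq> 0 \<longleftrightarrow> trivial_kernel ({..<s} \<times> {..<Q}) ({..<r + s} \<times> {..<P}) (T x)" by blast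
    obtain z where z: "D z * G z \<noteq> 0"
      using polyfun_common_nonzero[OF D(1) G(1)] D(2) x2 G(2) by force
    have "eta (r + s) (prodsp (span_of_coeffs (N + 1) r x) W) \<ge> eta s W"
      if "D x * G x \<noteq> 0" "csubspace W" "W \<subseteq> S (s - 1)" for x W
    proof -
      have "trivial_kernel ({..<s} \<times> {..<Q}) ({..<r + s} \<times> {..<P}) (T x)" using D(2) that(1) by simp
      then show ?thesis unfolding span_of_coeffs_def T_def
        by (intro semistable_of_trivial_kernel[OF degree_tuple_form assms(3) PQ _ that(2,3)])
    qed
    then show ?thesis unfolding general_subspace_def general_pt_def
      using True G(3) z polyfun.mult[OF D(1) G(1)]
      by (intro exI[of _ "\<lambda>x. D x * G x"]) auto
  qed
qed

end
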